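(* Let $A\in\mathbb{R}^{n\times n}$ and $B=[b_1,\ldots,b_m]\in\mathbb{R}^{n\times m}$. Suppose that $A$ is nonsingular and that all the pairs $(A,b_j)$, $j=1,\ldots,m$, are controllable. Let $x_0\in\mathscr{L}^{0-}(A)$ and $x_f\in\mathscr{L}^{0+}(A)$. Then for all sufficiently large $T>0$ there exists a maximum hands-off control for the system $\dot x=Ax+Bu$ from $x_0$ at $t=0$ to $x_f$ at $t=T$.
   Context: $\mathscr{L}^{-}(A)$, $\mathscr{L}^{0}(A)$, $\mathscr{L}^{+}(A)$ are the (real) generalized eigenspaces, i.e. $A$-invariant subspaces of $\mathbb{R}^n$, associated with the eigenvalues of $A$ in the open left half-plane, on the imaginary axis, and in the open right half-plane of $\mathbb{C}$, respectively; $\mathscr{L}^{0-}(A)=\mathscr{L}^{-}(A)\oplus\mathscr{L}^{0}(A)$ and $\mathscr{L}^{0+}(A)=\mathscr{L}^{+}(A)\oplus\mathscr{L}^{0}(A)$. $B_\infty$ is the closed unit ball of $L^\infty((0,T);\mathbb{R}^m)$ with norm $\max_{1\le i\le m}\operatorname{ess\,sup}_{[0,T]}|u^i(t)|$, i.e. the measurable $u=(u^1,\ldots,u^m)^\top$ with $|u^i(t)|\le 1$ for almost every $t\in[0,T]$ and all $i$. A control $u\in B_\infty$ takes $x_0$ at $t=0$ to $x_f$ at $t=T$ if the solution of $\dot x=Ax+Bu$, $x(0)=x_0$, satisfies $x(T)=x_f$. A maximum hands-off control (from $x_0$ at $t=0$ to $x_f$ at $t=T$) is a control that minimizes $\mu(\mathrm{supp}(u))$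 over all $u\in B_\infty$ that take $x_0$ at $t=0$ to $x_f$ at $t=T$, where $\mu$ is Lebesgue measure and $\mathrm{supp}(u)=\{t\in[0,T] : u(t)\neq 0\}$. *)

theory Defs
  imports "HOL-Analysis.Analysis"
begin

section \<open>Spectral subspaces of a real matrix\<close>

definition cvec :: "real^'n \<Rightarrow> complex^'n" where
  "cvec x = (\<chi> i. complex_of_real (x $ i))"

definition eigenval :: "complex^'n^'n \<Rightarrow> complex \<Rightarrow> bool" where
  "eigenval M z \<longleftrightarrow> (\<exists>v. v \<noteq> 0 \<and> M *v v = z *s v)"

definition gen_eigenspace :: "complex^'n^'n \<Rightarrow> complex \<Rightarrow> (complex^'n) set" where
  "gen_eigenspace M z = {v. \<exists>k. ((\<lambda>w. M *v w - z *s w) ^^ k) v = 0}"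

text \<open>
  The real vectors lying in the complex sum of the generalized eigenspaces that belong to the
  eigenvalues in \<open>\<Lambda>\<close>. For \<open>\<Lambda>\<close> closed under conjugation, as below, the complexification
  of this real subspace is that complex sum.
\<close>
definition spectral_subspace :: "complex set \<Rightarrow> real^'n^'n \<Rightarrow> (real^'n) set" where
  "spectral_subspace \<Lambda> A =
    (let M = map_matrix complex_of_real A
     in {x. cvec x \<in> vec.span (\<Union>z\<in>{z\<in>\<Lambda>. eigenval M z}. gen_eigenspace M z)})"

definition L_minus :: "real^'n^'n \<Rightarrow> (real^'n) set" where
  "L_minus A = spectral_subspace {z. Re z < 0} A"

definition L_zero :: "real^'n^'n \<Rightarrow> (real^'n) set" where
  "L_zero A = spectral_subspace {z. Re z = 0} A"

definition L_plus :: "real^'n^'n \<Rightarrow> (real^'n) set" where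
  "L_plus A = spectral_subspace {z. Re z > 0} A"

definition L_zero_minus :: "real^'n^'n \<Rightarrow> (real^'n) set" where
  "L_zero_minus A = {x + y | x y. x \<in> L_minus A \<and> y \<in> L_zero A}"

definition L_zero_plus :: "real^'n^'n \<Rightarrow> (real^'n) set" where
  "L_zero_plus A = {x + y | x y. x \<in> L_plus A \<and> y \<in> L_zero A}"


section \<open>Linear control systems\<close>

text \<open>
  Representatives of \<open>L\<^sup>\<infinity>((0,T); \<real>\<^sup>m)\<close>: Lebesgue measurable, essentially bounded
  functions on \<open>[0,T]\<close>; values outside \<open>[0,T]\<close> are irrelevant.
\<close>
definition Linfty_controls :: "real \<Rightarrow> (real \<Rightarrow> real^'m) set" where
  "Linfty_controls T =
    {u. u \<in> borel_measurable (lebesgue_on {0..T}) \<and>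
        (\<exists>c. \<forall>i. AE t in lebesgue_on {0..T}. \<bar>u t $ i\<bar> \<le> c)}"

definition B_infty :: "real \<Rightarrow> (real \<Rightarrow> real^'m) set" where
  "B_infty T =
    {u. u \<in> borel_measurable (lebesgue_on {0..T}) \<and>
        (\<forall>i. AE t in lebesgue_on {0..T}. \<bar>u t $ i\<bar> \<le> 1)}"

text \<open>
  Controls are only measurable, so a solution on \<open>[0,T]\<close> is meant in the sense of Caratheodory,
  in integrated form with a Lebesgue integrable right-hand side.
\<close>
definition solution ::
  "real^'n^'n \<Rightarrow> real^'m^'n \<Rightarrow> (real \<Rightarrow> real^'m) \<Rightarrow> real \<Rightarrow> real^'n \<Rightarrow> (real \<Rightarrow> real^'n) \<Rightarrow> bool"
  where
  "solution A B u T x0 x \<longleftrightarrow>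
    (\<lambda>s. A *v x s + B *v u s) absolutely_integrable_on {0..T} \<and>
    (\<forall>t\<in>{0..T}. x t = x0 + integral {0..t} (\<lambda>s. A *v x s + B *v u s))"

definition takes ::
  "real^'n^'n \<Rightarrow> real^'m^'n \<Rightarrow> (real \<Rightarrow> real^'m) \<Rightarrow> real \<Rightarrow> real^'n \<Rightarrow> real^'n \<Rightarrow> bool"
  where
  "takes A B u T x0 xf \<longleftrightarrow> (\<exists>x. solution A B u T x0 x \<and> x T = xf)"

definition controllable :: "real^'n^'n \<Rightarrow> real^'m^'n \<Rightarrow> bool" where
  "controllable A B \<longleftrightarrow>
    (\<forall>x0 xf. \<exists>T>0. \<exists>u\<in>Linfty_controls T. takes A B u T x0 xf)"


section \<open>Maximum hands-off control\<close>

definition supp :: "real \<Rightarrow> (real \<Rightarrow> real^'m) \<Rightarrow> real set" where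
  "supp T u = {t\<in>{0..T}. u t \<noteq> 0}"

definition max_hands_off ::
  "real^'n^'n \<Rightarrow> real^'m^'n \<Rightarrow> real \<Rightarrow> real^'n \<Rightarrow> real^'n \<Rightarrow> (real \<Rightarrow> real^'m) \<Rightarrow> bool"
  where
  "max_hands_off A B T x0 xf u \<longleftrightarrow>
    u \<in> B_infty T \<and> takes A B u T x0 xf \<and>
    (\<forall>v\<in>B_infty T. takes A B v T x0 xf \<longrightarrow>
       measure lebesgue (supp T u) \<le> measure lebesgue (supp T v))"

end

theory Submission
  imports Defs "HOL-Complex_Analysis.Conformal_Mappings"
begin

text \<open>
  The measure of the support is not convex in the control, but it is bounded below on the unit ball
  by the convex functional \<open>effort u = \<integral> max\<^sub>i |u\<^sub>i(t)| dt\<close>, with equality for controls that at each time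
  vanish or have some component of modulus \<open>1\<close> and none larger. So it is enough to find, among the
  feasible controls, one of minimal effort that has this bang-off-bang form.

  By variation of constants (\<open>takes_iff_steer\<close>) a control is feasible if and only if
  \<open>\<integral> e\<^sup>-\<^sup>A\<^sup>s B u(s) ds\<close> equals \<open>\<eta> = e\<^sup>-\<^sup>A\<^sup>T xf - x0\<close>. Separating the convex epigraph of the effort from the
  half-line below its infimum at \<open>\<eta>\<close> gives a multiplier \<open>(p, \<pi>)\<close> (\<open>effort_multiplier\<close>). With
  the row vector \<open>q(s) = p e\<^sup>-\<^sup>A\<^sup>s B\<close>, the Hamiltonian
  \<open>q \<bullet> u - \<pi> max\<^sub>i |u\<^sub>i|\<close> has a unique maximizer over the cube, of bang-off-bang form, unless
  \<open>\<Sum>|q\<^sub>i| = \<pi>\<close> or \<open>\<Sum>|q\<^sub>i| > \<pi>\<close> and some \<open>q\<^sub>i\<close> vanishes. As \<open>q\<close> is analytic, controllability of the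
  pairs and nonsingularity of \<open>A\<close> confine these exceptions to a countable set of times
  (\<open>switching_generic\<close>). Because the maximizer is unique, every minimizing sequence has a subsequence
  converging to it almost everywhere, so it is feasible and of minimal effort
  (\<open>minimal_effort_bang_control\<close>).

  Feasibility for large \<open>T\<close> is a statement about support functions (\<open>eventually_feasible\<close>): with \<open>b\<close> a
  column of \<open>B\<close>, one needs \<open>p \<bullet> \<eta> < \<integral>\<^sub>0\<^sup>T |p \<bullet> e\<^sup>-\<^sup>A\<^sup>s b| ds\<close> for all \<open>p \<noteq> 0\<close>. If this integral stays bounded
  as \<open>T\<close> grows, then the functional \<open>p\<close> transported along the flow tends to zero
  (\<open>bounded_gain_imp_decay\<close>), and such a functional annihilates all generalized eigenspaces with
  \<open>Re z \<le> 0\<close> (\<open>decay_annihilates_gen_eigenspace\<close>), hence \<open>x0\<close>.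
  So the integral is unbounded whenever \<open>p \<bullet> x0 \<noteq> 0\<close>. Reversal of time treats \<open>xf\<close> in the same
  way, and compactness of the unit sphere gives one \<open>T\<close> for all \<open>p\<close> (\<open>gain_eventually_dominates\<close>).
\<close>

section \<open>The matrix exponential\<close>

lemma bounded_bilinear_matrix_vector_mult:
  "bounded_bilinear ((*v) :: real^'n^'m \<Rightarrow> real^'n \<Rightarrow> real^'m)"
  unfolding bilinear_conv_bounded_bilinear[symmetric] bilinear_def
  by (auto intro!: linearI simp: matrix_vector_mult_add_rdistrib matrix_vector_right_distrib
      matrix_vector_mult_scaleR scaleR_matrix_vector_assoc)

lemma bounded_bilinear_vector_matrix_mult:
  "bounded_bilinear ((v*) :: real^'m \<Rightarrow> real^'n^'m \<Rightarrow> real^'n)"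
  unfolding bilinear_conv_bounded_bilinear[symmetric] bilinear_def
  by (auto intro!: linearI simp: vector_matrix_mult_def vec_eq_iff sum.distrib algebra_simps
      sum_distrib_left)

lemma bounded_bilinear_matrix_matrix_mult:
  "bounded_bilinear ((**) :: real^'n^'m \<Rightarrow> real^'k^'n \<Rightarrow> real^'k^'m)"
  unfolding bilinear_conv_bounded_bilinear[symmetric] bilinear_def
  by (auto intro!: linearI simp: matrix_matrix_mult_def vec_eq_iff sum.distrib algebra_simps
      sum_distrib_left)

interpretation mv: bounded_bilinear "(*v) :: real^'n^'m \<Rightarrow> real^'n \<Rightarrow> real^'m"
  by (rule bounded_bilinear_matrix_vector_mult)
interpretation vm: bounded_bilinear "(v*) :: real^'m \<Rightarrow> real^'n^'m \<Rightarrow> real^'n"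
  by (rule bounded_bilinear_vector_matrix_mult)
interpretation mm: bounded_bilinear "(**) :: real^'n^'m \<Rightarrow> real^'k^'n \<Rightarrow> real^'k^'m"
  by (rule bounded_bilinear_matrix_matrix_mult)

text \<open>
  The exponential is summed in the Banach space of matrices, so that every bounded linear functional
  of it is a power series in \<open>t\<close>; derivatives are read off from that series, and so is the
  entire extension behind \<open>countable_level_set_mexp\<close>.
\<close>
fun matpow :: "real^'n^'n \<Rightarrow> nat \<Rightarrow> real^'n^'n" where
  "matpow A 0 = mat 1"
| "matpow A (Suc k) = A ** matpow A k"

definition mexp :: "real^'n^'n \<Rightarrow> real \<Rightarrow> real^'n^'n" where
  "mexp A t = (\<Sum>k. (t ^ k / fact k) *\<^sub>R matpow A k)"

lemma matpow_commute: "matpow A k ** A = A ** matpow A k"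
  by (induction k) (auto simp: matrix_mul_assoc[symmetric])

lemma norm_matpow_le:
  fixes A :: "real^'n^'n"
  shows "\<exists>C K. \<forall>k. norm (matpow A k) \<le> C * K ^ k"
proof -
  obtain K where K: "K > 0" "\<And>(M :: real^'n^'n) (N :: real^'n^'n). norm (M ** N) \<le> norm M * norm N * K"
    using mm.pos_bounded by blast
  have "norm (matpow A k) \<le> norm (mat 1 :: real^'n^'n) * (norm A * K) ^ k" for k
  proof (induction k)
    case (Suc k)
    have "norm (matpow A (Suc k)) \<le> norm A * norm (matpow A k) * K"
      using K(2)[of A "matpow A k"] by (simp only: matpow.simps)
    also have "\<dots> \<le> norm A * (norm (mat 1 :: real^'n^'n) * (norm A * K) ^ k) * K"
      using Suc K by (intro mult_right_mono mult_left_mono) auto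
    finally show ?case by (simp add: mult_ac)
  qed auto
  then show ?thesis by blast
qed

lemma summable_norm_mexp: "summable (\<lambda>k. norm ((t ^ k / fact k) *\<^sub>R matpow A k))"
proof -
  obtain C K where CK: "\<And>k. norm (matpow A k) \<le> C * K ^ k"
    using norm_matpow_le by blast
  have "summable (\<lambda>k. C * ((\<bar>t\<bar> * K) ^ k / fact k))"
    using summable_exp[of "\<bar>t\<bar> * K"] by (intro summable_mult) (simp add: divide_inverse mult.commute)
  then show ?thesis
  proof (rule summable_comparison_test'[where N = 0])
    fix k :: nat
    have "norm ((t ^ k / fact k) *\<^sub>R matpow A k) \<le> (\<bar>t\<bar> ^ k / fact k) * (C * K ^ k)"
      using mult_left_mono[OF CK, of "\<bar>t\<bar> ^ k / fact k" k] by (simp add: power_abs)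
    also have "\<dots> = C * ((\<bar>t\<bar> * K) ^ k / fact k)"
      by (simp add: power_mult_distrib)
    finally show "norm (norm ((t ^ k / fact k) *\<^sub>R matpow A k)) \<le> C * ((\<bar>t\<bar> * K) ^ k / fact k)"
      by simp
  qed
qed

lemma linear_mexp_sums:
  assumes "bounded_linear L"
  shows "(\<lambda>k. (t ^ k / fact k) *\<^sub>R L (matpow A k)) sums L (mexp A t)"
proof -
  interpret L: bounded_linear L by fact
  have "(\<lambda>k. (t ^ k / fact k) *\<^sub>R matpow A k) sums mexp A t"
    unfolding mexp_def by (rule summable_sums[OF summable_norm_cancel[OF summable_norm_mexp]])
  from L.sums[OF this] show ?thesis by (simp add: L.scaleR)
qed

lemma summable_complex_mexp:
  fixes L :: "real^'n^'n \<Rightarrow> real"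
  assumes "bounded_linear L"
  shows "summable (\<lambda>k. complex_of_real (L (matpow A k) / fact k) * z ^ k)"
proof -
  obtain B where B: "\<And>x. norm (L x) \<le> norm x * B"
    using bounded_linear.pos_bounded[OF assms] by blast
  have "summable (\<lambda>k. B * norm ((norm z ^ k / fact k) *\<^sub>R matpow A k))"
    by (intro summable_mult summable_norm_mexp)
  then show ?thesis
  proof (rule summable_comparison_test'[where N = 0])
    fix k :: nat
    show "norm (complex_of_real (L (matpow A k) / fact k) * z ^ k)
       \<le> B * norm ((norm z ^ k / fact k) *\<^sub>R matpow A k)"
      using mult_left_mono[OF B[of "matpow A k"], of "norm z ^ k / fact k"]
      by (simp add: norm_mult norm_power norm_divide mult_ac)
  qed
qed

lemma summable_real_mexp:
  fixes L :: "real^'n^'n \<Rightarrow> real"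
  assumes "bounded_linear L"
  shows "summable (\<lambda>k. L (matpow A k) / fact k * t ^ k)"
  using sums_summable[OF linear_mexp_sums[OF assms, of t A]] by (simp add: mult_ac)

lemma linear_mexp_has_real_derivative:
  fixes L :: "real^'n^'n \<Rightarrow> real"
  assumes L: "bounded_linear L"
  shows "((\<lambda>t. L (mexp A t)) has_real_derivative L (A ** mexp A t)) (at t)"
proof -
  have eq: "L (mexp A t) = (\<Sum>k. L (matpow A k) / fact k * t ^ k)"
    if "bounded_linear L" for L :: "real^'n^'n \<Rightarrow> real" and t
    using sums_unique[OF linear_mexp_sums[OF that, of t A]] by (simp add: mult_ac)
  have LA: "bounded_linear (\<lambda>M. L (A ** M))"
    by (rule bounded_linear_compose[OF L mm.bounded_linear_right])
  have "diffs (\<lambda>k. L (matpow A k) / fact k) = (\<lambda>k. L (A ** matpow A k) / fact k)"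
    by (simp add: diffs_def fun_eq_iff divide_simps)
  then show ?thesis
    using termdiffs_strong_converges_everywhere[OF summable_real_mexp[OF L, of A], of t]
    by (simp add: eq[OF L] eq[OF LA])
qed

lemma has_vector_derivative_vec:
  fixes f :: "real \<Rightarrow> ('a::euclidean_space)^'n"
  assumes "\<And>i. ((\<lambda>t. f t $ i) has_vector_derivative f' $ i) (at t within S)"
  shows "(f has_vector_derivative f') (at t within S)"
  unfolding has_vector_derivative_def
proof (subst has_derivative_componentwise_within, safe)
  fix b :: "'a^'n" assume "b \<in> Basis"
  then obtain i u where b: "b = axis i u" "u \<in> Basis"
    by (auto simp: Basis_vec_def)
  have "((\<lambda>t. f t $ i \<bullet> u) has_derivative (\<lambda>x. (x *\<^sub>R f' $ i) \<bullet> u)) (at t within S)"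
    using assms[of i] unfolding has_vector_derivative_def
    by (intro has_derivative_inner_left)
  then show "((\<lambda>x. f x \<bullet> b) has_derivative (\<lambda>x. (x *\<^sub>R f') \<bullet> b)) (at t within S)"
    by (simp add: b inner_axis)
qed

lemma mexp_has_vector_derivative [derivative_intros]:
  fixes A :: "real^'n^'n"
  shows "(mexp A has_vector_derivative A ** mexp A t) (at t within S)"
proof (rule has_vector_derivative_at_within, intro has_vector_derivative_vec)
  fix i j :: 'n
  have "bounded_linear (\<lambda>M :: real^'n^'n. M $ i $ j)"
    using bounded_linear_compose[OF bounded_linear_vec_nth bounded_linear_vec_nth] .
  from linear_mexp_has_real_derivative[OF this, of A t]
  show "((\<lambda>s. mexp A s $ i $ j) has_vector_derivative (A ** mexp A t) $ i $ j) (at t)"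
    by (simp add: has_real_derivative_iff_has_vector_derivative)
qed

lemma mexp_commute: "mexp A t ** A = A ** mexp A t"
  using linear_mexp_sums[OF mm.bounded_linear_left, of t A A]
      linear_mexp_sums[OF mm.bounded_linear_right, of t A A]
  unfolding matpow_commute by (rule sums_unique2)

lemma mexp_0 [simp]: "mexp A 0 = mat 1"
proof -
  have eq: "(\<lambda>k. (0 ^ k / fact k) *\<^sub>R matpow A k) = (\<lambda>k. if k = 0 then mat 1 else 0)"
    by auto
  show ?thesis
    unfolding mexp_def eq by (rule sums_unique[symmetric], rule sums_single)
qed

lemma continuous_on_mexp [continuous_intros]:
  assumes "continuous_on S f"
  shows "continuous_on S (\<lambda>x. mexp A (f x))"
proof -
  have "continuous_on UNIV (mexp A)"
    by (rule continuous_on_vector_derivative[where f' = "\<lambda>t. A ** mexp A t"])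
      (rule mexp_has_vector_derivative)
  then show ?thesis
    using continuous_on_compose2[OF _ assms] by blast
qed

lemma has_vector_derivative_mexp_affine:
  "((\<lambda>s. mexp A (c * s + d)) has_vector_derivative c *\<^sub>R (A ** mexp A (c * s + d))) (at s within S)"
proof -
  have "((\<lambda>s. c * s + d) has_vector_derivative c) (at s within S)"
    by (auto intro!: derivative_eq_intros)
  from vector_diff_chain_within[OF this, of "mexp A" "A ** mexp A (c * s + d)"]
  show ?thesis
    by (simp add: o_def mexp_has_vector_derivative)
qed

text \<open>
  The derivative in \<open>s\<close> vanishes, so the value at \<open>s = 0\<close> is attained for all \<open>s\<close>. This
  one identity contains both the inverse law and the semigroup law.
\<close>
lemma mexp_cancel_add: "mexp A (- s) ** mexp A (s + t) = mexp A t"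
proof -
  let ?f = "\<lambda>s. mexp A (- s) ** mexp A (s + t)"
  have "(?f has_vector_derivative 0) (at s within UNIV)" for s
  proof -
    have "((\<lambda>s. mexp A ((-1) * s + 0) ** mexp A (1 * s + t)) has_vector_derivative 
       mexp A ((-1) * s + 0) ** (1 *\<^sub>R (A ** mexp A (1 * s + t)))
       + ((-1) *\<^sub>R (A ** mexp A ((-1) * s + 0))) ** mexp A (1 * s + t)) (at s within UNIV)"
      by (intro mm.has_vector_derivative has_vector_derivative_mexp_affine)
    then show ?thesis
      by (simp add: mm.minus_left matrix_mul_assoc mexp_commute)
  qed
  then obtain c where "\<And>s. ?f s = c"
    by (rule has_vector_derivative_zero_constant[OF convex_UNIV]) auto
  from this[of s] this[of 0] show ?thesis by simp
qed

lemma mexp_minus_mult: "mexp A (- s) ** mexp A s = mat 1" "mexp A s ** mexp A (- s) = mat 1"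
  using mexp_cancel_add[of A s 0] mexp_cancel_add[of A "- s" 0] by auto

lemma mexp_add: "mexp A (s + t) = mexp A s ** mexp A t"
proof -
  have "mexp A s ** (mexp A (- s) ** mexp A (s + t)) = mexp A (s + t)"
    by (simp add: matrix_mul_assoc mexp_minus_mult)
  then show ?thesis by (simp add: mexp_cancel_add)
qed

lemma vector_mexp_eq_0_iff: "p v* mexp A t = 0 \<longleftrightarrow> p = 0"
proof
  assume "p v* mexp A t = 0"
  then have "(p v* mexp A t) v* mexp A (- t) = 0" by simp
  then show "p = 0"
    by (simp add: vector_matrix_mul_assoc mexp_minus_mult)
qed auto

lemma inner_mexp_has_real_derivative:
  fixes A :: "real^'n^'n"
  shows "((\<lambda>t. p \<bullet> (mexp A t *v c)) has_real_derivative p \<bullet> (mexp A t *v (A *v c))) (at t)"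
proof -
  have "bounded_linear (\<lambda>M :: real^'n^'n. p \<bullet> (M *v c))"
    by (rule bounded_linear_compose[OF bounded_linear_inner_right mv.bounded_linear_left])
  from linear_mexp_has_real_derivative[OF this, of A t] show ?thesis
    by (simp add: matrix_vector_mul_assoc mexp_commute)
qed

text \<open>
  The function \<open>t \<mapsto> p \<bullet> (mexp A t *v c)\<close> is the restriction of an entire function, and the zeros of
  an entire function that does not vanish identically are countable.
\<close>
lemma countable_level_set_mexp:
  fixes A :: "real^'n^'n"
  assumes "p \<bullet> (mexp A t0 *v c) \<noteq> \<kappa>"
  shows "countable {t. p \<bullet> (mexp A t *v c) = \<kappa>}"
proof -
  define L where "L M = p \<bullet> (M *v c)" for M :: "real^'n^'n"
  have L: "bounded_linear L"
    unfolding L_def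
    by (rule bounded_linear_compose[OF bounded_linear_inner_right mv.bounded_linear_left])
  define F where "F z = (\<Sum>k. complex_of_real (L (matpow A k) / fact k) * z ^ k) - of_real \<kappa>" for z
  have F_real: "F (of_real t) = of_real (L (mexp A t) - \<kappa>)" for t
  proof -
    have "(\<lambda>k. complex_of_real ((t ^ k / fact k) *\<^sub>R L (matpow A k))) sums of_real (L (mexp A t))"
      by (intro sums_of_real linear_mexp_sums L)
    from sums_unique[OF this] show ?thesis
      by (simp add: F_def mult_ac)
  qed
  have "F field_differentiable at z" for z
    using DERIV_diff[OF termdiffs_strong_converges_everywhere[OF summable_complex_mexp[OF L, of A], of z]
        DERIV_const[of "of_real \<kappa>"]]
    unfolding F_def field_differentiable_def by blast
  then have F_hol: "F holomorphic_on UNIV"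
    by (simp add: holomorphic_on_def)
  have "countable {z. F z = 0}"
  proof (cases "F constant_on UNIV")
    case True
    then have "F z = F (of_real t0)" for z
      by (auto simp: constant_on_def)
    then show ?thesis using assms by (simp add: F_real L_def)
  next
    case False
    then show ?thesis
      using holomorphic_countable_zeros[OF F_hol] by (simp add: convex_connected)
  qed
  moreover have "complex_of_real ` {t. p \<bullet> (mexp A t *v c) = \<kappa>} \<subseteq> {z. F z = 0}"
    by (auto simp: F_real L_def)
  ultimately have "countable (complex_of_real ` {t. p \<bullet> (mexp A t *v c) = \<kappa>})"
    using countable_subset by blast
  then show ?thesis
    by (rule countable_image_inj_on) (simp add: inj_on_def)
qed

section \<open>Solutions of the control system\<close>

text \<open>
  The continuity of \<open>G\<close> makes the bound \<open>o(s - t)\<close>, so \<open>\<phi>\<close> has derivative zero at every single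
  point. That is stronger than zero almost everywhere, which would not suffice.
\<close>
lemma constant_if_increments_small:
  fixes \<phi> :: "real \<Rightarrow> 'a::real_normed_vector" and G :: "real \<Rightarrow> real"
  assumes G: "continuous_on {0..T} G"
    and incr: "\<And>s t. \<lbrakk>0 \<le> t; t \<le> s; s \<le> T\<rbrakk> \<Longrightarrow> norm (\<phi> s - \<phi> t) \<le> L * (s - t) * (G s - G t)"
    and "t \<in> {0..T}" and "0 \<le> L"
  shows "\<phi> t = \<phi> 0"
proof -
  have sym: "norm (\<phi> s - \<phi> t) \<le> L * \<bar>s - t\<bar> * \<bar>G s - G t\<bar>" if "s \<in> {0..T}" "t \<in> {0..T}" for s t
  proof (cases "t \<le> s")
    case True
    have "norm (\<phi> s - \<phi> t) \<le> L * (s - t) * (G s - G t)"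
      using that True by (intro incr) auto
    also have "\<dots> \<le> L * \<bar>s - t\<bar> * \<bar>G s - G t\<bar>"
      using True \<open>0 \<le> L\<close> by (simp add: mult_left_mono)
    finally show ?thesis .
  next
    case False
    have "norm (\<phi> t - \<phi> s) \<le> L * (t - s) * (G t - G s)"
      using that False by (intro incr) auto
    also have "\<dots> \<le> L * \<bar>s - t\<bar> * \<bar>G s - G t\<bar>"
      using False \<open>0 \<le> L\<close> by (simp add: mult_left_mono)
    finally show ?thesis by (simp add: norm_minus_commute)
  qed
  have "(\<phi> has_derivative (\<lambda>h. 0)) (at s within {0..T})" if s: "s \<in> {0..T}" for s
    unfolding has_derivative_within_alt
  proof (intro conjI allI impI)
    fix e :: real assume "e > 0"
    then have "e / (L + 1) > 0" using \<open>0 \<le> L\<close> by simp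
    then obtain d where d: "d > 0" "\<And>r. r \<in> {0..T} \<Longrightarrow> dist r s < d \<Longrightarrow> dist (G r) (G s) < e / (L + 1)"
      using G s unfolding continuous_on_iff by metis
    have "norm (\<phi> r - \<phi> s - 0) \<le> e * norm (r - s)" if r: "r \<in> {0..T}" "norm (r - s) < d" for r
    proof -
      have "\<bar>G r - G s\<bar> \<le> e / (L + 1)"
        using d(2)[of r] r by (simp add: dist_real_def)
      then have "L * \<bar>G r - G s\<bar> \<le> L * (e / (L + 1))"
        using \<open>0 \<le> L\<close> by (intro mult_left_mono)
      also have "\<dots> \<le> e"
        using \<open>0 \<le> L\<close> \<open>e > 0\<close> by (simp add: field_simps)
      finally have "L * \<bar>G r - G s\<bar> * \<bar>r - s\<bar> \<le> e * \<bar>r - s\<bar>"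
        by (intro mult_right_mono) auto
      then show ?thesis using sym[OF r(1) s] by (simp add: mult_ac)
    qed
    then show "\<exists>d>0. \<forall>r\<in>{0..T}. norm (r - s) < d \<longrightarrow> norm (\<phi> r - \<phi> s - 0) \<le> e * norm (r - s)"
      using \<open>d > 0\<close> by blast
  qed (rule bounded_linear_zero)
  then obtain c where "\<And>s. s \<in> {0..T} \<Longrightarrow> \<phi> s = c"
    using has_derivative_zero_constant[of "{0..T}" \<phi>] by auto
  with \<open>t \<in> {0..T}\<close> show ?thesis by simp
qed

lemma absolutely_integrable_matrix_vector:
  fixes F :: "real \<Rightarrow> real^'n^'m" and g :: "real \<Rightarrow> real^'n"
  assumes "continuous_on {0..T} F" "g absolutely_integrable_on {0..T}"
  shows "(\<lambda>s. F s *v g s) absolutely_integrable_on {0..T}"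
proof (rule absolutely_integrable_bounded_measurable_product[where h = "(*v)" and f = F and g = g])
  show "bilinear ((*v) :: real^'n^'m \<Rightarrow> real^'n \<Rightarrow> real^'m)"
    by (simp add: bilinear_conv_bounded_bilinear bounded_bilinear_matrix_vector_mult)
  show "F \<in> borel_measurable (lebesgue_on {0..T})"
    using assms(1) by (intro continuous_imp_measurable_on_sets_lebesgue) auto
  show "bounded (F ` {0..T})"
    by (intro compact_imp_bounded compact_continuous_image assms) auto
qed (use assms in auto)

lemma integral_split_diff:
  fixes f :: "real \<Rightarrow> 'a::banach"
  assumes "f integrable_on {0..T}" "0 \<le> t" "t \<le> s" "s \<le> T"
  shows "(f has_integral integral {0..s} f - integral {0..t} f) {t..s}"
proof -
  have "f integrable_on {0..s}" "f integrable_on {t..s}"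
    using assms by (auto intro: integrable_on_subinterval)
  then show ?thesis
    using Henstock_Kurzweil_Integration.integral_combine[of 0 t s f] assms by (metis add_diff_cancel_left' has_integral_integrable_integral)
qed

text \<open>
  The product rule \<open>(F w)' = F' w + F g\<close> for a function \<open>w\<close> that is only absolutely continuous with
  density \<open>g\<close>. The difference \<open>\<phi>\<close> of the two sides has increments
  \<open>\<integral>\<^sub>t\<^sup>s F'(r) (w(s) - w(r)) + (F(t) - F(r)) g(r) dr\<close>. Both terms are at most a constant times
  \<open>(s - t) \<integral>\<^sub>t\<^sup>s |g|\<close>, the first because \<open>w\<close> moves by at most the integral of \<open>|g|\<close>, the second
  because \<open>F\<close> is Lipschitz; hence \<open>\<phi>\<close> is constant.
\<close>
lemma has_integral_matrix_product_rule:
  fixes F F' :: "real \<Rightarrow> real^'n^'n" and g w :: "real \<Rightarrow> real^'n"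
  assumes F: "\<And>t. t \<in> {0..T} \<Longrightarrow> (F has_vector_derivative F' t) (at t within {0..T})"
    and F': "continuous_on {0..T} F'"
    and g: "g absolutely_integrable_on {0..T}"
    and w: "\<And>t. t \<in> {0..T} \<Longrightarrow> w t = w0 + integral {0..t} g"
    and T: "t \<in> {0..T}"
  shows "((\<lambda>s. F' s *v w s + F s *v g s) has_integral F t *v w t - F 0 *v w0) {0..t}"
proof -
  define G where "G t = integral {0..t} (\<lambda>s. norm (g s))" for t
  define h where "h s = F' s *v w s + F s *v g s" for s
  define \<phi> where "\<phi> t = F t *v w t - integral {0..t} h" for t
  have g_int: "g integrable_on {0..T}" and ng_int: "(\<lambda>s. norm (g s)) integrable_on {0..T}"
    using g by (auto simp: absolutely_integrable_on_def)
  have G_cont: "continuous_on {0..T} G"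
    unfolding G_def by (rule indefinite_integral_continuous_1[OF ng_int])
  have "continuous_on {0..T} (\<lambda>t. w0 + integral {0..t} g)"
    by (intro continuous_intros indefinite_integral_continuous_1[OF g_int])
  then have w_cont: "continuous_on {0..T} w"
    by (rule continuous_on_eq) (simp add: w)
  have F_cont: "continuous_on {0..T} F"
    using F by (rule continuous_on_vector_derivative)
  have "(\<lambda>s. F' s *v w s) absolutely_integrable_on {0..T}"
    by (intro absolutely_integrable_matrix_vector F' absolutely_integrable_continuous_real w_cont)
  then have h_int: "h integrable_on {0..T}"
    unfolding h_def
    by (intro integrable_add absolutely_integrable_matrix_vector[OF F_cont g, THEN set_lebesgue_integral_eq_integral(1)])
      (auto dest: set_lebesgue_integral_eq_integral(1))
  \<comment> \<open>\<open>K0\<close> is the constant of the bilinear product, \<open>K1\<close> a bound for \<open>F'\<close> and so a Lipschitz constant of \<open>F\<close>.\<close>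
  obtain K0 where K0: "K0 > 0" "\<And>M x. norm (M *v x) \<le> norm (M :: real^'n^'n) * norm (x :: real^'n) * K0"
    using mv.pos_bounded by blast
  obtain K1 where K1: "K1 > 0" "\<And>s. s \<in> {0..T} \<Longrightarrow> norm (F' s) \<le> K1"
    using compact_imp_bounded[OF compact_continuous_image[OF F' compact_Icc]]
    unfolding bounded_pos by auto
  have F_lip: "norm (F s - F t) \<le> K1 * (s - t)" if "0 \<le> t" "t \<le> s" "s \<le> T" for s t
  proof -
    have "norm (F s - F t) \<le> K1 * norm (s - t)"
      using F K1(2) that
      by (intro differentiable_bound[of "{0..T}" F "\<lambda>x h. h *\<^sub>R F' x"])
        (auto simp: has_vector_derivative_def onorm_scaleR_left onorm_id
          intro!: onorm_le mult_left_mono simp: mult.commute)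
    then show ?thesis using that by simp
  qed
  have w_diff: "norm (w s - w t) \<le> G s - G t" if "0 \<le> t" "t \<le> s" "s \<le> T" for s t
  proof -
    have "w s - w t = integral {t..s} g"
      using w[of s] w[of t] that integral_split_diff[OF g_int that] by (auto simp: has_integral_iff)
    also have "norm \<dots> \<le> integral {t..s} (\<lambda>r. norm (g r))"
      using that by (intro Henstock_Kurzweil_Integration.integral_norm_bound_integral
          integrable_on_subinterval[OF g_int] integrable_on_subinterval[OF ng_int]) auto
    also have "\<dots> = G s - G t"
      using integral_split_diff[OF ng_int that] by (auto simp: has_integral_iff G_def)
    finally show ?thesis .
  qed
  have G_mono: "G t \<le> G s" if "0 \<le> t" "t \<le> s" "s \<le> T" for s t
    using order_trans[OF norm_ge_zero w_diff[OF that]] by simp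
  have incr: "norm (\<phi> s - \<phi> t) \<le> (2 * K0 * K1) * (s - t) * (G s - G t)"
    if st: "0 \<le> t" "t \<le> s" "s \<le> T" for s t
  proof -
    have "(F' has_integral F s - F t) {t..s}"
      using st F by (intro fundamental_theorem_of_calculus)
        (auto intro: has_vector_derivative_within_subset[of _ _ _ "{0..T}"])
    from has_integral_linear[OF this mv.bounded_linear_left[of "w s"]]
    have 1: "((\<lambda>r. F' r *v w s) has_integral (F s - F t) *v w s) {t..s}"
      by (simp add: o_def)
    have "(g has_integral w s - w t) {t..s}"
      using w[of s] w[of t] st integral_split_diff[OF g_int st] by auto
    from has_integral_linear[OF this mv.bounded_linear_right[of "F t"]]
    have 2: "((\<lambda>r. F t *v g r) has_integral F t *v (w s - w t)) {t..s}"
      by (simp add: o_def)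
    have 3: "(h has_integral integral {0..s} h - integral {0..t} h) {t..s}"
      by (rule integral_split_diff[OF h_int st])
    have 4: "((\<lambda>r. F' r *v w s + F t *v g r - h r) has_integral
        (F s - F t) *v w s + F t *v (w s - w t) - (integral {0..s} h - integral {0..t} h)) {t..s}"
      by (intro has_integral_diff has_integral_add 1 2 3)
    have \<phi>: "((\<lambda>r. F' r *v (w s - w r) + (F t - F r) *v g r) has_integral \<phi> s - \<phi> t) {t..s}"
    proof -
      have "F' r *v w s + F t *v g r - h r = F' r *v (w s - w r) + (F t - F r) *v g r" for r
        by (simp add: h_def mv.diff_left mv.diff_right)
      moreover have "(F s - F t) *v w s + F t *v (w s - w t) - (integral {0..s} h - integral {0..t} h)
          = \<phi> s - \<phi> t"
        by (simp add: \<phi>_def mv.diff_left mv.diff_right)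
      ultimately show ?thesis
        using 4 by simp
    qed
    have bnd: "((\<lambda>r. K0 * K1 * (G s - G t) + (K0 * K1 * (s - t)) * norm (g r)) has_integral
        (s - t) * (K0 * K1 * (G s - G t)) + (K0 * K1 * (s - t)) * (G s - G t)) {t..s}"
      using has_integral_const_real[of "K0 * K1 * (G s - G t)" t s] st integral_split_diff[OF ng_int st]
      by (intro has_integral_add has_integral_mult_right) (auto simp: G_def)
    have "norm (\<phi> s - \<phi> t) \<le> (s - t) * (K0 * K1 * (G s - G t)) + (K0 * K1 * (s - t)) * (G s - G t)"
    proof -
      have "norm (F' r *v (w s - w r) + (F t - F r) *v g r)
          \<le> K0 * K1 * (G s - G t) + (K0 * K1 * (s - t)) * norm (g r)" if r: "r \<in> {t..s}" for r
      proof -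
        have "norm (F' r *v (w s - w r)) \<le> norm (F' r) * norm (w s - w r) * K0"
          by (rule K0)
        also have "\<dots> \<le> K1 * (G s - G t) * K0"
          using r st K0(1) K1 w_diff[of r s] G_mono[of t r] G_mono[of t s] by (intro mult_mono) auto
        finally have a: "norm (F' r *v (w s - w r)) \<le> K0 * K1 * (G s - G t)" by (simp add: mult_ac)
        have "norm ((F t - F r) *v g r) \<le> norm (F t - F r) * norm (g r) * K0"
          by (rule K0)
        also have "\<dots> \<le> (K1 * (s - t)) * norm (g r) * K0"
        proof (intro mult_right_mono)
          have "norm (F t - F r) \<le> K1 * (r - t)"
            using F_lip[of t r] r st by (simp add: norm_minus_commute)
          also have "\<dots> \<le> K1 * (s - t)" using r K1(1) by (intro mult_left_mono) auto
          finally show "norm (F t - F r) \<le> K1 * (s - t)" .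
        qed (use K0 in auto)
        finally have "norm ((F t - F r) *v g r) \<le> (K0 * K1 * (s - t)) * norm (g r)" by (simp add: mult_ac)
        with a show ?thesis by (smt (verit) norm_triangle_ineq)
      qed
      then show ?thesis
        using Henstock_Kurzweil_Integration.integral_norm_bound_integral
          [OF has_integral_integrable[OF \<phi>] has_integral_integrable[OF bnd]]
        by (simp add: integral_unique[OF \<phi>] integral_unique[OF bnd])
    qed
    then show ?thesis by (simp add: algebra_simps)
  qed
  have "\<phi> t = \<phi> 0"
    by (rule constant_if_increments_small[OF G_cont incr T]) (use K0 K1 in auto)
  then have "integral {0..t} h = F t *v w t - F 0 *v w0"
    using w[of 0] T by (simp add: \<phi>_def algebra_simps)
  moreover have "h integrable_on {0..t}"
    using h_int T by (auto intro: integrable_on_subinterval)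
  ultimately have "(h has_integral F t *v w t - F 0 *v w0) {0..t}"
    by (simp add: has_integral_iff)
  then show ?thesis
    by (simp add: h_def[abs_def])
qed

lemma mexp_scaled_has_vector_derivative:
  "((\<lambda>s. mexp A (c * s)) has_vector_derivative c *\<^sub>R (A ** mexp A (c * s))) (at s within S)"
  using has_vector_derivative_mexp_affine[of A c 0 s S] by simp

text \<open>
  Variation of constants: multiply the solution by \<open>mexp A (- t)\<close> and apply the product rule. The
  terms containing the state cancel pointwise.
\<close>
lemma takes_imp_has_integral:
  assumes "takes A B u T x0 xf" "0 \<le> T"
  shows "((\<lambda>s. mexp A (- s) *v (B *v u s)) has_integral mexp A (- T) *v xf - x0) {0..T}"
proof -
  obtain x where x: "(\<lambda>s. A *v x s + B *v u s) absolutely_integrable_on {0..T}"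
    "\<And>t. t \<in> {0..T} \<Longrightarrow> x t = x0 + integral {0..t} (\<lambda>s. A *v x s + B *v u s)" "x T = xf"
    using assms(1) unfolding takes_def solution_def by auto
  have "((\<lambda>s. (- 1) *\<^sub>R (A ** mexp A ((-1) * s)) *v x s + mexp A ((-1) * s) *v (A *v x s + B *v u s))
      has_integral mexp A ((-1) * T) *v x T - mexp A ((-1) * 0) *v x0) {0..T}"
    by (rule has_integral_matrix_product_rule[where T = T, OF mexp_scaled_has_vector_derivative _ x(1,2)])
      (use assms(2) in \<open>auto intro!: continuous_intros mm.continuous_on\<close>)
  then show ?thesis
    by (simp add: x(3) mv.add_right mv.minus_left matrix_vector_mul_assoc mexp_commute)
qed

text \<open>
  Conversely, the trajectory is written down as \<open>mexp A t\<close> times the primitive of the pulled-back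
  input.
\<close>
lemma has_integral_imp_takes:
  assumes u: "(\<lambda>s. B *v u s) absolutely_integrable_on {0..T}" and "0 \<le> T"
    and int: "((\<lambda>s. mexp A (- s) *v (B *v u s)) has_integral mexp A (- T) *v xf - x0) {0..T}"
  shows "takes A B u T x0 xf"
proof -
  define g where "g s = mexp A (- s) *v (B *v u s)" for s
  define w where "w t = x0 + integral {0..t} g" for t
  define x where "x t = mexp A t *v w t" for t
  have g: "g absolutely_integrable_on {0..T}"
    unfolding g_def by (intro absolutely_integrable_matrix_vector u continuous_intros)
  have cont: "continuous_on {0..T} w"
    unfolding w_def using g
    by (intro continuous_intros indefinite_integral_continuous_1) (auto simp: absolutely_integrable_on_def)
  have rhs: "(A ** mexp A s) *v w s + mexp A s *v g s = A *v x s + B *v u s" for s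
    by (simp add: g_def x_def matrix_vector_mul_assoc matrix_mul_assoc mexp_minus_mult)
  have hi: "((\<lambda>s. A *v x s + B *v u s) has_integral x t - x0) {0..t}" if "t \<in> {0..T}" for t
    using has_integral_matrix_product_rule[where T = T and F = "mexp A" and w = w,
        OF mexp_has_vector_derivative _ g w_def that]
    by (simp add: rhs x_def continuous_intros mm.continuous_on)
  have "(\<lambda>s. A *v x s + B *v u s) absolutely_integrable_on {0..T}"
    unfolding x_def
    by (intro set_integral_add u absolutely_integrable_continuous_real mv.continuous_on continuous_intros cont)
  moreover have "x t = x0 + integral {0..t} (\<lambda>s. A *v x s + B *v u s)" if "t \<in> {0..T}" for t
    using integral_unique[OF hi[OF that]] by simp
  moreover have "x T = xf"
    using integral_unique[OF int, folded g_def]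
    by (simp add: x_def w_def mv.diff_right matrix_vector_mul_assoc mexp_minus_mult)
  ultimately show ?thesis
    unfolding takes_def solution_def by blast
qed

text \<open>
  If \<open>p\<close> is orthogonal to the curve \<open>t \<mapsto> mexp A t *v b\<close>, then no input moves the state in the
  direction \<open>p\<close>; steering \<open>- p\<close> to \<open>0\<close> gives \<open>p \<bullet> p = 0\<close>.
\<close>
lemma controllable_imp_observable:
  fixes A :: "real^'n^'n" and b :: "real^'n"
  assumes ctrl: "controllable A (columnvector b :: real^1^'n)"
    and zero: "\<And>t. p \<bullet> (mexp A t *v b) = 0"
  shows "p = 0"
proof -
  obtain T u where T: "T > 0" "takes A (columnvector b :: real^1^'n) u T (- p) 0"
    using ctrl unfolding controllable_def by meson
  have "columnvector b *v u s = u s $ 1 *\<^sub>R b" for s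
    by (simp add: vec_eq_iff matrix_vector_mult_def columnvector_def mult.commute)
  then have "((\<lambda>s. mexp A (- s) *v (u s $ 1 *\<^sub>R b)) has_integral p) {0..T}"
    using takes_imp_has_integral[OF T(2)] T(1) by simp
  from has_integral_linear[OF this bounded_linear_inner_right[of p]]
  have "((\<lambda>s. 0) has_integral p \<bullet> p) {0..T}"
    by (simp add: o_def mv.scaleR_right zero)
  then show ?thesis
    using has_integral_unique[OF has_integral_0] by force
qed

section \<open>Growth of the gain and the spectral subspaces\<close>

definition observable :: "real^'n^'n \<Rightarrow> real^'n \<Rightarrow> bool" where
  "observable A b \<longleftrightarrow> (\<forall>p. (\<forall>t. p \<bullet> (mexp A t *v b) = 0) \<longrightarrow> p = 0)"

text \<open>
  For \<open>a = - 1\<close> this is the support function, in direction \<open>p\<close>, of the set of points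
  \<open>\<integral> mexp A (- s) *v (u s *\<^sub>R b) ds\<close> with a scalar input \<open>|u| \<le> 1\<close> on \<open>[0, T]\<close>. The initial state
  needs \<open>a = - 1\<close>; the target state, whose problem is the time reversal, needs \<open>a = 1\<close>.
\<close>
definition gain :: "real^'n^'n \<Rightarrow> real^'n \<Rightarrow> real \<Rightarrow> real \<Rightarrow> real^'n \<Rightarrow> real" where
  "gain A b a T p = integral {0..T} (\<lambda>s. \<bar>p \<bullet> (mexp A (a * s) *v b)\<bar>)"

lemma gain_integrand_continuous:
  "continuous_on S (\<lambda>s. \<bar>p \<bullet> (mexp A (a * s) *v b)\<bar>)"
  by (intro continuous_intros mv.continuous_on)

lemma gain_integrable:
  "(\<lambda>s. \<bar>p \<bullet> (mexp A (a * s) *v b)\<bar>) integrable_on {S..T}"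
  by (intro integrable_continuous_real gain_integrand_continuous)

lemma gain_mono: "S \<le> T \<Longrightarrow> gain A b a S p \<le> gain A b a T p"
  unfolding gain_def by (intro integral_subset_le gain_integrable) auto

lemma gain_scaleR: "gain A b a T (r *\<^sub>R p) = \<bar>r\<bar> * gain A b a T p"
  unfolding gain_def by (simp add: abs_mult integral_mult_right)

lemma gain_continuous: "continuous_on S (gain A b a T)"
proof -
  have "continuous_on (S \<times> cbox 0 T) (\<lambda>(p, s). \<bar>p \<bullet> (mexp A (a * s) *v b)\<bar>)"
    unfolding split_beta by (intro continuous_intros mv.continuous_on)
  from integral_continuous_on_param[OF this] show ?thesis
    by (simp add: gain_def[abs_def])
qed

lemma gain_add:
  assumes "0 \<le> S" "0 \<le> T"
  shows "gain A b a (S + T) p = gain A b a S p + gain A b a T (p v* mexp A (a * S))"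
proof -
  have "gain A b a T (p v* mexp A (a * S)) = integral {S - S..(S + T) - S} (\<lambda>s. \<bar>p \<bullet> (mexp A (a * (s + S)) *v b)\<bar>)"
    by (simp add: gain_def dot_lmul_matrix matrix_vector_mul_assoc add.commute distrib_left flip: mexp_add)
  also have "\<dots> = integral {S..S + T} (\<lambda>s. \<bar>p \<bullet> (mexp A (a * s) *v b)\<bar>)"
    by (rule integral_shift_real_ivl)
  finally show ?thesis
    unfolding gain_def
    using assms by (simp add: Henstock_Kurzweil_Integration.integral_combine gain_integrable)
qed

lemma gain_pos:
  assumes "observable A b" "a \<noteq> 0" "T > 0" "p \<noteq> 0"
  shows "gain A b a T p > 0"
proof -
  have "gain A b a T p \<ge> 0"
    unfolding gain_def by (intro Henstock_Kurzweil_Integration.integral_nonneg gain_integrable) auto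
  moreover have "gain A b a T p \<noteq> 0"
  proof
    assume "gain A b a T p = 0"
    then have 0: "p \<bullet> (mexp A (a * s) *v b) = 0" if "s \<in> {0..T}" for s
      using integral_eq_0_iff[OF gain_integrand_continuous, of 0 T p A a b] that assms(3)
      unfolding gain_def by auto
    obtain t where "p \<bullet> (mexp A t *v b) \<noteq> 0"
      using assms(1,4) unfolding observable_def by auto
    from countable_level_set_mexp[OF this]
    have "countable ((\<lambda>s. a * s) ` {0..T})"
      by (rule countable_subset[rotated]) (use 0 in auto)
    then have "countable {0..T}"
      by (rule countable_image_inj_on) (use assms(2) in \<open>simp add: inj_on_def\<close>)
    then show False
      using uncountable_closed_interval[of 0 T] assms(3) by simp
  qed
  ultimately show ?thesis by simp
qed

text \<open>
  By observability \<open>gain A b a 1\<close> is a norm on a finite-dimensional space, hence bounded below by a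
  multiple of the given one.
\<close>
lemma gain_lower_bound:
  fixes A :: "real^'n^'n"
  assumes "observable A b" "a \<noteq> 0"
  obtains c where "c > 0" "\<And>p. c * norm p \<le> gain A b a 1 p"
proof -
  have "sphere (0 :: real^'n) 1 \<noteq> {}"
    by simp
  then obtain q where q: "q \<in> sphere 0 1" "\<And>p. p \<in> sphere 0 1 \<Longrightarrow> gain A b a 1 q \<le> gain A b a 1 p"
    using continuous_attains_inf[OF compact_sphere _ gain_continuous] by metis
  show ?thesis
  proof
    show "gain A b a 1 q > 0"
      using q(1) assms by (intro gain_pos) auto
    show "gain A b a 1 q * norm p \<le> gain A b a 1 p" for p
    proof (cases "p = 0")
      case False
      then have "gain A b a 1 q \<le> gain A b a 1 ((1 / norm p) *\<^sub>R p)"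
        by (intro q(2)) simp
      then show ?thesis
        using False by (simp add: gain_scaleR field_simps)
    qed (simp add: gain_def)
  qed
qed

text \<open>
  The gain over \<open>[n, n + 1]\<close> is the unit-time gain of the transported functional
  \<open>p v* mexp A (a n)\<close>. The increments of a bounded monotone sequence tend to zero, and by
  \<open>gain_lower_bound\<close> the functionals tend to zero with them.
\<close>
lemma bounded_gain_imp_decay:
  fixes A :: "real^'n^'n"
  assumes obs: "observable A b" "a \<noteq> 0" and bnd: "\<And>n::nat. gain A b a (real n) p \<le> C"
  shows "(\<lambda>n. p v* mexp A (a * real n)) \<longlonglongrightarrow> 0"
proof -
  obtain c where c: "c > 0" "\<And>p. c * norm p \<le> gain A b a 1 p"
    using gain_lower_bound[OF obs] by blast
  let ?g = "\<lambda>n. gain A b a (real n) p"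
  have "incseq ?g"
    by (auto simp: incseq_def intro: gain_mono)
  then obtain L where L: "?g \<longlonglongrightarrow> L"
    by (rule incseq_convergent[of ?g C]) (use bnd in auto)
  have lim: "(\<lambda>n. (?g (Suc n) - ?g n) / c) \<longlonglongrightarrow> (L - L) / c"
    by (intro tendsto_intros LIMSEQ_Suc L) (use c in auto)
  have bound: "\<forall>n. norm (p v* mexp A (a * real n)) \<le> (?g (Suc n) - ?g n) / c"
  proof
    fix n
    have "?g (Suc n) = ?g n + gain A b a 1 (p v* mexp A (a * real n))"
      using gain_add[of "real n" 1 A b a p] by (simp add: add.commute[of 1])
    then have "c * norm (p v* mexp A (a * real n)) \<le> ?g (Suc n) - ?g n"
      using c(2)[of "p v* mexp A (a * real n)"] by linarith
    then show "norm (p v* mexp A (a * real n)) \<le> (?g (Suc n) - ?g n) / c"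
      using c(1) by (simp add: pos_le_divide_eq mult.commute)
  qed
  show ?thesis
    by (rule Lim_null_comparison[OF always_eventually[OF bound] lim[unfolded diff_self div_0]])
qed

text \<open>
  The complexification of the functional \<open>x \<mapsto> p \<bullet> x\<close>; it is bilinear, not sesquilinear, so that it
  is linear on the complex generalized eigenspaces.
\<close>
definition cdot :: "real^'n \<Rightarrow> complex^'n \<Rightarrow> complex" where
  "cdot p v = (\<Sum>i\<in>UNIV. of_real (p $ i) * v $ i)"

lemma cdot_cvec: "cdot p (cvec x) = of_real (p \<bullet> x)"
  by (simp add: cdot_def cvec_def inner_vec_def)

lemma cdot_matrix: "cdot (p v* A) v = cdot p (map_matrix complex_of_real A *v v)"
  unfolding cdot_def matrix_vector_mult_def vector_matrix_mult_def map_matrix_def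
  by (simp add: sum_distrib_left sum_distrib_right mult_ac) (rule sum.swap)

lemma cdot_diff_scale: "cdot p (v - z *s w) = cdot p v - z * cdot p w"
  by (simp add: cdot_def sum_subtractf sum_distrib_left algebra_simps)

lemma bounded_linear_cdot: "bounded_linear (\<lambda>p. cdot p v)"
  unfolding linear_conv_bounded_linear[symmetric]
proof (rule linearI)
  show "cdot (p + q) v = cdot p v + cdot q v" for p q
    by (simp add: cdot_def sum.distrib algebra_simps)
  show "cdot (r *\<^sub>R p) v = r *\<^sub>R cdot p v" for r p
    by (simp add: cdot_def scaleR_sum_right) (simp add: scaleR_conv_of_real mult_ac)
qed

lemma norm_growth:
  fixes h :: "real \<Rightarrow> complex"
  assumes h: "\<And>s. (h has_vector_derivative z * h s) (at s)" and "Re z \<ge> 0" "t \<ge> 0"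
  shows "norm (h 0) \<le> norm (h t)"
proof -
  let ?k = "\<lambda>s. exp (s *\<^sub>R (- z)) * h s"
  have "(?k has_vector_derivative 0) (at s within UNIV)" for s
    using has_vector_derivative_mult[OF exp_scaleR_has_vector_derivative_right[of "- z" s UNIV] h[of s]]
    by (simp add: algebra_simps)
  then obtain c where c: "\<And>s. ?k s = c"
    by (rule has_vector_derivative_zero_constant[OF convex_UNIV]) auto
  have "h 0 = ?k t"
    using c[of 0] c[of t] by simp
  then have "norm (h 0) = exp (- t * Re z) * norm (h t)"
    by (simp add: norm_mult)
  also have "\<dots> \<le> 1 * norm (h t)"
    using assms by (intro mult_right_mono) auto
  finally show ?thesis by simp
qed

text \<open>
  Induction on the exponent \<open>k\<close> with \<open>(A - z)\<^sup>k v = 0\<close>. The induction hypothesis, applied to all the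
  transported functionals, kills \<open>(A - z) v\<close>; hence the value of the functional transported to time
  \<open>s\<close> at \<open>v\<close> solves the scalar equation \<open>h' = a z h\<close>. Since \<open>a Re z \<ge> 0\<close>, its modulus does not
  decrease, but it tends to zero.
\<close>
lemma decay_annihilates_gen_eigenspace:
  fixes A :: "real^'n^'n"
  assumes decay: "(\<lambda>n. p v* mexp A (a * real n)) \<longlonglongrightarrow> 0"
    and z: "a * Re z \<ge> 0"
    and v: "v \<in> gen_eigenspace (map_matrix complex_of_real A) z"
  shows "cdot p v = 0"
proof -
  let ?M = "map_matrix complex_of_real A"
  let ?N = "\<lambda>w. ?M *v w - z *s w"
  obtain k where "(?N ^^ k) v = 0"
    using v unfolding gen_eigenspace_def by auto
  then show ?thesis
    using decay
  proof (induction k arbitrary: v p)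
    case 0
    then show ?case by (simp add: cdot_def)
  next
    case (Suc k)
    let ?h = "\<lambda>s. cdot (p v* mexp A (a * s)) v"
    have Nv: "cdot (p v* mexp A (a * s)) (?N v) = 0" for s
    proof (rule Suc.IH)
      show "(?N ^^ k) (?N v) = 0"
        using Suc.prems(1) by (simp only: funpow_Suc_right comp_apply)
      have "(\<lambda>n. (p v* mexp A (a * real n)) v* mexp A (a * s)) \<longlonglongrightarrow> 0 v* mexp A (a * s)"
        by (intro vm.tendsto Suc.prems(2) tendsto_const)
      then show "(\<lambda>n. (p v* mexp A (a * s)) v* mexp A (a * real n)) \<longlonglongrightarrow> 0"
        by (simp add: vector_matrix_mul_assoc add.commute flip: mexp_add)
    qed
    have "(?h has_vector_derivative (of_real a * z) * ?h s) (at s)" for s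
    proof -
      have "(?h has_vector_derivative cdot (p v* (a *\<^sub>R (A ** mexp A (a * s)))) v) (at s)"
        by (intro bounded_linear.has_vector_derivative[OF bounded_linear_cdot]
            bounded_linear.has_vector_derivative[OF vm.bounded_linear_right]
            mexp_scaled_has_vector_derivative)
      also have "cdot (p v* (a *\<^sub>R (A ** mexp A (a * s)))) v = of_real a * cdot (p v* mexp A (a * s)) (?M *v v)"
      proof -
        have "p v* (a *\<^sub>R (A ** mexp A (a * s))) = a *\<^sub>R ((p v* mexp A (a * s)) v* A)"
          by (simp only: vm.scaleR_right mexp_commute vector_matrix_mul_assoc)
        then show ?thesis
          by (simp only: linear_scale[OF bounded_linear.linear[OF bounded_linear_cdot]]
              cdot_matrix) (simp only: scaleR_conv_of_real)
      qed
      also have "\<dots> = (of_real a * z) * ?h s"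
        using Nv[of s] by (simp add: cdot_diff_scale)
      finally show ?thesis .
    qed
    then have "norm (?h 0) \<le> norm (?h (real n))" for n
      using z by (intro norm_growth[where z = "of_real a * z"]) auto
    moreover have "(\<lambda>n. norm (?h (real n))) \<longlonglongrightarrow> norm (cdot 0 v)"
      by (intro tendsto_norm bounded_linear.tendsto[OF bounded_linear_cdot] Suc.prems(2))
    ultimately have "norm (?h 0) \<le> norm (cdot 0 v)"
      by (intro Lim_bounded2[where N = 0]) auto
    then show ?case
      by (simp add: cdot_def)
  qed
qed

lemma annihilates_spectral_subspace:
  assumes "x \<in> spectral_subspace \<Lambda> A"
    and "\<And>z v. z \<in> \<Lambda> \<Longrightarrow> v \<in> gen_eigenspace (map_matrix complex_of_real A) z \<Longrightarrow> cdot p v = 0"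
  shows "p \<bullet> x = 0"
proof -
  let ?G = "\<Union>z\<in>{z\<in>\<Lambda>. eigenval (map_matrix complex_of_real A) z}.
    gen_eigenspace (map_matrix complex_of_real A) z"
  have "vec.subspace {v. cdot p v = 0}"
    by (auto simp: vec.subspace_def cdot_def algebra_simps sum.distrib simp flip: sum_distrib_left)
  then have "vec.span ?G \<subseteq> {v. cdot p v = 0}"
    using assms(2) by (intro vec.span_minimal) auto
  moreover have "cvec x \<in> vec.span ?G"
    using assms(1) by (simp add: spectral_subspace_def Let_def)
  ultimately have "cdot p (cvec x) = 0" by auto
  then show ?thesis by (simp add: cdot_cvec)
qed

lemma decay_annihilates_spectral_subspace:
  assumes "x \<in> spectral_subspace \<Lambda> A" "\<And>z. z \<in> \<Lambda> \<Longrightarrow> a * Re z \<ge> 0"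
    and "(\<lambda>n. p v* mexp A (a * real n)) \<longlonglongrightarrow> 0"
  shows "p \<bullet> x = 0"
  using assms(1)
  by (rule annihilates_spectral_subspace) (rule decay_annihilates_gen_eigenspace[OF assms(3) assms(2)])

lemma decay_annihilates_L_zero_minus:
  assumes "x \<in> L_zero_minus A" "(\<lambda>n. p v* mexp A (- 1 * real n)) \<longlonglongrightarrow> 0"
  shows "p \<bullet> x = 0"
  using assms(1) decay_annihilates_spectral_subspace[OF _ _ assms(2), of _ "{z. Re z < 0}"]
    decay_annihilates_spectral_subspace[OF _ _ assms(2), of _ "{z. Re z = 0}"]
  unfolding L_zero_minus_def L_minus_def L_zero_def by (auto simp: inner_add_right)

lemma decay_annihilates_L_zero_plus:
  assumes "x \<in> L_zero_plus A" "(\<lambda>n. p v* mexp A (1 * real n)) \<longlonglongrightarrow> 0"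
  shows "p \<bullet> x = 0"
  using assms(1) decay_annihilates_spectral_subspace[OF _ _ assms(2), of _ "{z. Re z > 0}"]
    decay_annihilates_spectral_subspace[OF _ _ assms(2), of _ "{z. Re z = 0}"]
  unfolding L_zero_plus_def L_plus_def L_zero_def by (auto simp: inner_add_right)

text \<open>
  For a single \<open>p\<close> the inequality holds eventually: a bounded gain would force \<open>p \<bullet> x = 0\<close>, while the
  gain is positive. Compactness of the unit sphere and monotonicity in \<open>T\<close> make the time uniform
  in \<open>p\<close>.
\<close>
lemma gain_eventually_dominates:
  fixes A :: "real^'n^'n"
  assumes obs: "observable A b" "a \<noteq> 0"
    and x: "\<And>p. (\<lambda>n. p v* mexp A (a * real n)) \<longlonglongrightarrow> 0 \<Longrightarrow> p \<bullet> x = 0"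
  obtains T0 where "\<And>T p. T0 \<le> T \<Longrightarrow> p \<noteq> 0 \<Longrightarrow> 2 * \<bar>p \<bullet> x\<bar> < gain A b a T p"
proof -
  have "\<exists>N::nat. \<forall>p\<in>sphere 0 1. 2 * \<bar>p \<bullet> x\<bar> < gain A b a N p"
  proof (rule ccontr)
    assume "\<not> ?thesis"
    then have "\<forall>N::nat. \<exists>p\<in>sphere 0 1. gain A b a N p \<le> 2 * \<bar>p \<bullet> x\<bar>"
      by (simp add: not_less)
    then obtain P where P: "\<And>N::nat. P N \<in> sphere 0 1" "\<And>N. gain A b a (real N) (P N) \<le> 2 * \<bar>P N \<bullet> x\<bar>"
      by metis
    obtain p r where p: "p \<in> sphere 0 1" and r: "strict_mono r" "(P \<circ> r) \<longlonglongrightarrow> p"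
      using compact_imp_seq_compact[OF compact_sphere, THEN seq_compactE, of P] P(1) by metis
    have bnd: "gain A b a (real m) p \<le> 2 * \<bar>p \<bullet> x\<bar>" for m :: nat
    proof (rule LIMSEQ_le)
      show "(\<lambda>n. 2 * \<bar>(P \<circ> r) n \<bullet> x\<bar>) \<longlonglongrightarrow> 2 * \<bar>p \<bullet> x\<bar>"
        by (intro tendsto_intros r)
      show "(\<lambda>n. gain A b a (real m) ((P \<circ> r) n)) \<longlonglongrightarrow> gain A b a (real m) p"
        using continuous_on_tendsto_compose[OF gain_continuous[of UNIV] r(2)] by simp
      have "gain A b a (real m) (P (r n)) \<le> 2 * \<bar>P (r n) \<bullet> x\<bar>" if "n \<ge> m" for n
        using gain_mono[of m "r n" A b a "P (r n)"] P(2)[of "r n"] seq_suble[OF r(1), of n] that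
        by simp
      then show "\<exists>N. \<forall>n\<ge>N. gain A b a (real m) ((P \<circ> r) n) \<le> 2 * \<bar>(P \<circ> r) n \<bullet> x\<bar>"
        by auto
    qed
    then have "p \<bullet> x = 0"
      by (intro x bounded_gain_imp_decay[OF obs])
    moreover have "p \<noteq> 0" using p by auto
    ultimately show False
      using bnd[of 1] gain_pos[OF obs, of 1 p] by simp
  qed
  then obtain N :: nat where N: "\<And>p. p \<in> sphere 0 1 \<Longrightarrow> 2 * \<bar>p \<bullet> x\<bar> < gain A b a N p"
    by blast
  show ?thesis
  proof
    fix T p assume "real N \<le> T" "p \<noteq> (0 :: real^'n)"
    then have "2 * \<bar>((1 / norm p) *\<^sub>R p) \<bullet> x\<bar> < gain A b a N ((1 / norm p) *\<^sub>R p)"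
      by (intro N) simp
    then have "2 * \<bar>p \<bullet> x\<bar> < gain A b a N p"
      using \<open>p \<noteq> 0\<close> by (simp add: gain_scaleR abs_mult field_simps)
    also have "\<dots> \<le> gain A b a T p"
      using \<open>real N \<le> T\<close> by (rule gain_mono)
    finally show "2 * \<bar>p \<bullet> x\<bar> < gain A b a T p" .
  qed
qed

lemma gain_time_reversal:
  "gain A b 1 T (p v* mexp A (- T)) = gain A b (- 1) T p"
proof -
  have "integral {0..T} (\<lambda>s. \<bar>p \<bullet> (mexp A (s - T) *v b)\<bar>)
      = integral {- T - (- T)..0 - (- T)} (\<lambda>s. \<bar>p \<bullet> (mexp A (s + (- T)) *v b)\<bar>)"
    by simp
  also have "\<dots> = integral {- T..- 0} (\<lambda>s. \<bar>p \<bullet> (mexp A (- (- s)) *v b)\<bar>)"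
    by (subst integral_shift_real_ivl) simp
  also have "\<dots> = integral {0..T} (\<lambda>s. \<bar>p \<bullet> (mexp A (- s) *v b)\<bar>)"
    by (rule Henstock_Kurzweil_Integration.integral_reflect_real)
  finally show ?thesis
    by (simp add: gain_def dot_lmul_matrix matrix_vector_mul_assoc flip: mexp_add)
qed

section \<open>Steering, effort and the pointwise maximum principle\<close>

lemma absolutely_integrable_iff_integrable:
  "f absolutely_integrable_on {0..T} \<longleftrightarrow> integrable (lebesgue_on {0..T}) f"
  for f :: "real \<Rightarrow> 'a::euclidean_space"
  by (simp add: set_integrable_def integrable_restrict_space)

lemma infnorm_le_iff_cart: "infnorm x \<le> c \<longleftrightarrow> (\<forall>i. \<bar>x $ i\<bar> \<le> c)" for x :: "real^'n"
proof
  show "infnorm x \<le> c \<Longrightarrow> \<forall>i. \<bar>x $ i\<bar> \<le> c"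
    using component_le_infnorm_cart order_trans by blast
  show "\<forall>i. \<bar>x $ i\<bar> \<le> c \<Longrightarrow> infnorm x \<le> c"
    unfolding infnorm_cart by (rule cSup_least) auto
qed

lemma norm_le_infnorm_cart: "norm x \<le> sqrt (real CARD('n)) * infnorm x" for x :: "real^'n"
  using norm_le_infnorm[of x] by simp

lemma borel_measurable_infnorm [measurable]: "infnorm \<in> borel_measurable borel"
  by (intro borel_measurable_continuous_onI continuous_on_infnorm continuous_on_id)

lemma B_infty_iff:
  "u \<in> B_infty T \<longleftrightarrow>
    u \<in> borel_measurable (lebesgue_on {0..T}) \<and> (AE s in lebesgue_on {0..T}. infnorm (u s) \<le> 1)"
  unfolding B_infty_def infnorm_le_iff_cart AE_all_countable by simp

lemma finite_measure_lebesgue_on_Icc: "finite_measure (lebesgue_on {0..T::real})"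
  by (rule finite_measure_lebesgue_on) simp

lemma B_infty_integrable:
  fixes u :: "real \<Rightarrow> real^'m"
  assumes "u \<in> B_infty T"
  shows "integrable (lebesgue_on {0..T}) u"
proof (rule finite_measure.integrable_const_bound[OF finite_measure_lebesgue_on_Icc])
  show "AE s in lebesgue_on {0..T}. norm (u s) \<le> sqrt (real CARD('m))"
    using assms unfolding B_infty_iff
  proof (elim conjE AE_mp, intro AE_I2 impI)
    fix s assume "infnorm (u s) \<le> 1"
    then have "sqrt (real CARD('m)) * infnorm (u s) \<le> sqrt (real CARD('m)) * 1"
      by (intro mult_left_mono) auto
    with norm_le_infnorm_cart[of "u s"] show "norm (u s) \<le> sqrt (real CARD('m))" by linarith
  qed
qed (use assms B_infty_iff in auto)

lemma B_infty_infnorm_integrable: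
  assumes "u \<in> B_infty T"
  shows "integrable (lebesgue_on {0..T}) (\<lambda>s. infnorm (u s))"
proof (rule finite_measure.integrable_const_bound[OF finite_measure_lebesgue_on_Icc])
  show "AE s in lebesgue_on {0..T}. norm (infnorm (u s)) \<le> 1"
    using assms unfolding B_infty_iff by (simp add: real_abs_infnorm)
  show "(\<lambda>s. infnorm (u s)) \<in> borel_measurable (lebesgue_on {0..T})"
    using assms unfolding B_infty_iff by (auto intro: measurable_compose[OF _ borel_measurable_infnorm])
qed

text \<open>
  The displacement produced by \<open>u\<close> over \<open>[0, T]\<close>, pulled back to time \<open>0\<close> by the free flow.
\<close>
definition steer :: "real^'n^'n \<Rightarrow> real^'m^'n \<Rightarrow> real \<Rightarrow> (real \<Rightarrow> real^'m) \<Rightarrow> real^'n" where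
  "steer A B T u = integral\<^sup>L (lebesgue_on {0..T}) (\<lambda>s. mexp A (- s) *v (B *v u s))"

text \<open>
  The convex relaxation of the measure of the support: since the support counts a time as soon as
  one component of \<open>u\<close> is nonzero, the integrand is the maximum of the components and not their sum.
\<close>
definition effort :: "real \<Rightarrow> (real \<Rightarrow> real^'m) \<Rightarrow> real" where
  "effort T u = integral\<^sup>L (lebesgue_on {0..T}) (\<lambda>s. infnorm (u s))"

text \<open>
  The costate \<open>p v* mexp A (- s)\<close> seen through the inputs: \<open>p \<bullet> steer A B T u\<close> is the integral of
  \<open>switching A B p s \<bullet> u s\<close>.
\<close>
definition switching :: "real^'n^'n \<Rightarrow> real^'m^'n \<Rightarrow> real^'n \<Rightarrow> real \<Rightarrow> real^'m" where
  "switching A B p s = (p v* mexp A (- s)) v* B"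

lemma switching_inner: "switching A B p s \<bullet> v = p \<bullet> (mexp A (- s) *v (B *v v))"
  by (simp add: switching_def dot_lmul_matrix)

lemma switching_nth: "switching A B p s $ j = p \<bullet> (mexp A (- s) *v column j B)"
  using switching_inner[of A B p s "axis j 1"]
  by (simp add: inner_axis matrix_vector_mult_basis)

lemma continuous_on_switching: "continuous_on S (switching A B p)"
  unfolding switching_def[abs_def] by (intro vm.continuous_on continuous_intros)

lemma B_infty_absolutely_integrable:
  fixes B :: "real^'m^'n"
  assumes "u \<in> B_infty T"
  shows "(\<lambda>s. B *v u s) absolutely_integrable_on {0..T}"
  using absolutely_integrable_matrix_vector[of T "\<lambda>_. B" u] B_infty_integrable[OF assms]
  by (simp add: absolutely_integrable_iff_integrable)

lemma steer_integrable:
  assumes "u \<in> B_infty T"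
  shows "integrable (lebesgue_on {0..T}) (\<lambda>s. mexp A (- s) *v (B *v u s))"
  unfolding absolutely_integrable_iff_integrable[symmetric]
  by (intro absolutely_integrable_matrix_vector B_infty_absolutely_integrable assms continuous_intros)

lemma switching_integrable:
  assumes "u \<in> B_infty T"
  shows "integrable (lebesgue_on {0..T}) (\<lambda>s. switching A B p s \<bullet> u s)"
  unfolding switching_inner by (intro integrable_inner_right steer_integrable assms)

lemma inner_steer:
  assumes "u \<in> B_infty T"
  shows "p \<bullet> steer A B T u = integral\<^sup>L (lebesgue_on {0..T}) (\<lambda>s. switching A B p s \<bullet> u s)"
  unfolding switching_inner steer_def by (rule integral_inner_right[symmetric, OF steer_integrable[OF assms]])

lemma takes_iff_steer:
  assumes u: "u \<in> B_infty T" and "0 \<le> T"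
  shows "takes A B u T x0 xf \<longleftrightarrow> steer A B T u = mexp A (- T) *v xf - x0"
proof
  have int: "((\<lambda>s. mexp A (- s) *v (B *v u s)) has_integral steer A B T u) {0..T}"
    unfolding steer_def by (intro has_integral_integral_lebesgue_on steer_integrable u) simp
  show "steer A B T u = mexp A (- T) *v xf - x0" if "takes A B u T x0 xf"
    using has_integral_unique[OF int takes_imp_has_integral[OF that \<open>0 \<le> T\<close>]] .
  show "takes A B u T x0 xf" if "steer A B T u = mexp A (- T) *v xf - x0"
    using has_integral_imp_takes[OF B_infty_absolutely_integrable[OF u] \<open>0 \<le> T\<close>] int that by simp
qed

lemma B_infty_convex_comb:
  assumes u: "u \<in> B_infty T" and v: "v \<in> B_infty T" and "0 \<le> a" "0 \<le> b" "a + b = 1"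
  shows "(\<lambda>s. a *\<^sub>R u s + b *\<^sub>R v s) \<in> B_infty T"
    and "steer A B T (\<lambda>s. a *\<^sub>R u s + b *\<^sub>R v s) = a *\<^sub>R steer A B T u + b *\<^sub>R steer A B T v"
    and "effort T (\<lambda>s. a *\<^sub>R u s + b *\<^sub>R v s) \<le> a * effort T u + b * effort T v"
proof -
  have le: "infnorm (a *\<^sub>R x + b *\<^sub>R y) \<le> a * infnorm x + b * infnorm y" for x y :: "real^'m"
    using infnorm_triangle[of "a *\<^sub>R x" "b *\<^sub>R y"] assms(3,4) by (simp add: infnorm_mul)
  show w: "(\<lambda>s. a *\<^sub>R u s + b *\<^sub>R v s) \<in> B_infty T"
    unfolding B_infty_iff
  proof
    show "(\<lambda>s. a *\<^sub>R u s + b *\<^sub>R v s) \<in> borel_measurable (lebesgue_on {0..T})"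
      using u v unfolding B_infty_iff by (intro borel_measurable_add borel_measurable_scaleR) auto
    have "AE s in lebesgue_on {0..T}. infnorm (u s) \<le> 1" "AE s in lebesgue_on {0..T}. infnorm (v s) \<le> 1"
      using u v unfolding B_infty_iff by auto
    then show "AE s in lebesgue_on {0..T}. infnorm (a *\<^sub>R u s + b *\<^sub>R v s) \<le> 1"
    proof eventually_elim
      case (elim s)
      have "a * infnorm (u s) + b * infnorm (v s) \<le> a * 1 + b * 1"
        using elim assms(3,4) by (intro add_mono mult_left_mono)
      with le[of "u s" "v s"] assms(5) show ?case by simp
    qed
  qed
  show "steer A B T (\<lambda>s. a *\<^sub>R u s + b *\<^sub>R v s) = a *\<^sub>R steer A B T u + b *\<^sub>R steer A B T v"
    unfolding steer_def mv.add_right mv.scaleR_right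
    using steer_integrable[OF u, of A B] steer_integrable[OF v, of A B]
    by (subst Bochner_Integration.integral_add) (rule integrable_scaleR_right | simp only: integral_scaleR_right)+
  have "effort T (\<lambda>s. a *\<^sub>R u s + b *\<^sub>R v s)
      \<le> integral\<^sup>L (lebesgue_on {0..T}) (\<lambda>s. a * infnorm (u s) + b * infnorm (v s))"
    unfolding effort_def using u v w le
    by (intro integral_mono Bochner_Integration.integrable_add integrable_mult_right B_infty_infnorm_integrable)
  also have "\<dots> = a * effort T u + b * effort T v"
    using B_infty_infnorm_integrable[OF u] B_infty_infnorm_integrable[OF v] by (simp add: effort_def)
  finally show "effort T (\<lambda>s. a *\<^sub>R u s + b *\<^sub>R v s) \<le> a * effort T u + b * effort T v" .
qed

text \<open>
  The pointwise maximizer of \<open>q \<bullet> u - \<pi> * infnorm u\<close> over the cube: the best value on the sphere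
  \<open>infnorm u = r\<close> is \<open>r (\<Sum>|q\<^sub>i| - \<pi>)\<close>, so \<open>r\<close> is \<open>0\<close> or \<open>1\<close> according to the sign.
\<close>
definition bang :: "real \<Rightarrow> real^'m \<Rightarrow> real^'m" where
  "bang \<pi> q = (if \<pi> < (\<Sum>i\<in>UNIV. \<bar>q $ i\<bar>) then \<chi> i. sgn (q $ i) else 0)"

lemma bang_measurable [measurable]: "(bang \<pi> :: real^'m \<Rightarrow> real^'m) \<in> borel_measurable borel"
proof (subst borel_measurable_euclidean_space, rule ballI)
  fix b :: "real^'m" assume "b \<in> Basis"
  then obtain i where b: "b = axis i 1" by (auto simp: Basis_vec_def)
  have [measurable]: "(\<lambda>x :: real^'m. x $ i) \<in> borel_measurable borel" for i
    by (intro borel_measurable_continuous_onI continuous_intros)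
  have "(\<lambda>x :: real^'m. if \<pi> < (\<Sum>i\<in>UNIV. \<bar>x $ i\<bar>) then sgn (x $ i) else 0) \<in> borel_measurable borel"
    by measurable
  also have "(\<lambda>x. if \<pi> < (\<Sum>i\<in>UNIV. \<bar>x $ i\<bar>) then sgn (x $ i) else 0) = (\<lambda>x. bang \<pi> x \<bullet> b)"
    by (auto simp: bang_def b inner_axis)
  finally show "(\<lambda>x. bang \<pi> x \<bullet> b) \<in> borel_measurable borel" .
qed

text \<open>
  Once some component of the control is on, its maximum norm is \<open>1\<close>; this is why effort and measure of
  the support agree on such controls.
\<close>
lemma infnorm_bang:
  assumes "\<pi> \<ge> 0"
  shows "infnorm (bang \<pi> q) = (if bang \<pi> q = 0 then 0 else 1)"
proof (cases "bang \<pi> q = 0")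
  case False
  then obtain i where i: "bang \<pi> q $ i \<noteq> 0" by (auto simp: vec_eq_iff)
  then have "\<bar>bang \<pi> q $ i\<bar> = 1" by (auto simp: bang_def sgn_if split: if_splits)
  then have "infnorm (bang \<pi> q) \<ge> 1" using component_le_infnorm_cart[of "bang \<pi> q" i] by simp
  moreover have "infnorm (bang \<pi> q) \<le> 1"
    unfolding infnorm_le_iff_cart by (auto simp: bang_def sgn_if)
  ultimately show ?thesis using False by simp
qed (simp add: infnorm_0)

lemma bang_in_B_infty:
  assumes "\<pi> \<ge> 0" "continuous_on {0..T} q"
  shows "(\<lambda>s. bang \<pi> (q s)) \<in> B_infty T"
proof -
  have [measurable]: "q \<in> borel_measurable (lebesgue_on {0..T})"
    using assms(2) by (intro continuous_imp_measurable_on_sets_lebesgue) auto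
  have "(\<lambda>s. bang \<pi> (q s)) \<in> borel_measurable (lebesgue_on {0..T})"
    by measurable
  then show ?thesis
    unfolding B_infty_iff by (auto intro!: AE_I2 simp: infnorm_bang[OF assms(1)])
qed

lemma effort_le_measure_supp:
  assumes "u \<in> B_infty T"
  shows "effort T u \<le> measure lebesgue (supp T u)"
    and "(\<And>s. infnorm (u s) = (if u s = 0 then 0 else 1)) \<Longrightarrow> effort T u = measure lebesgue (supp T u)"
proof -
  let ?M = "lebesgue_on {0..T}"
  interpret finite_measure ?M by (rule finite_measure_lebesgue_on_Icc)
  have [measurable]: "u \<in> borel_measurable ?M"
    using assms B_infty_iff by auto
  have "{s \<in> space ?M. u s \<noteq> 0} \<in> sets ?M"
    by measurable
  then have sets: "supp T u \<in> sets ?M"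
    by (simp add: supp_def)
  have int: "integrable ?M (indicat_real (supp T u))"
    using sets by (intro integrable_real_indicator) (simp_all add: less_top[symmetric])
  have m: "integral\<^sup>L ?M (indicat_real (supp T u)) = measure lebesgue (supp T u)"
  proof -
    have "integral\<^sup>L ?M (indicat_real (supp T u)) = measure ?M (supp T u)"
    proof -
      have "supp T u \<inter> {0..T} = supp T u" by (auto simp: supp_def)
      then show ?thesis by simp
    qed
    also have "\<dots> = measure lebesgue (supp T u)"
      by (rule measure_restrict_space) (auto simp: supp_def)
    finally show ?thesis .
  qed
  have "AE s in ?M. infnorm (u s) \<le> 1"
    using assms B_infty_iff by auto
  then have "AE s in ?M. infnorm (u s) \<le> indicat_real (supp T u) s"
    by (rule AE_mp) (auto intro!: AE_I2 simp: supp_def indicator_def infnorm_0)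
  then show "effort T u \<le> measure lebesgue (supp T u)"
    unfolding m[symmetric] effort_def
    by (intro integral_mono_AE B_infty_infnorm_integrable assms int)
  show "effort T u = measure lebesgue (supp T u)" if "\<And>s. infnorm (u s) = (if u s = 0 then 0 else 1)"
    unfolding m[symmetric] effort_def
    by (intro Bochner_Integration.integral_cong refl) (auto simp: that supp_def)
qed

definition hamiltonian :: "real \<Rightarrow> real^'m \<Rightarrow> real^'m \<Rightarrow> real" where
  "hamiltonian \<pi> q u = q \<bullet> u - \<pi> * infnorm u"

lemma bang_hamiltonian:
  assumes "\<pi> \<ge> 0"
  shows "hamiltonian \<pi> q (bang \<pi> q) = max 0 ((\<Sum>i\<in>UNIV. \<bar>q $ i\<bar>) - \<pi>)"
proof (cases "\<pi> < (\<Sum>i\<in>UNIV. \<bar>q $ i\<bar>)")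
  case True
  have "bang \<pi> q \<noteq> 0"
  proof
    assume "bang \<pi> q = 0"
    then have "q $ i = 0" for i using True by (auto simp: bang_def vec_eq_iff sgn_zero_iff)
    then show False using True assms by simp
  qed
  moreover have "q \<bullet> bang \<pi> q = (\<Sum>i\<in>UNIV. \<bar>q $ i\<bar>)"
    using True by (simp add: bang_def inner_vec_def abs_sgn)
  ultimately show ?thesis
    using True infnorm_bang[OF assms, of q] by (simp add: hamiltonian_def)
qed (simp add: bang_def hamiltonian_def infnorm_0)

lemma hamiltonian_gap:
  fixes q u :: "real^'m"
  shows "((\<Sum>i\<in>UNIV. \<bar>q $ i\<bar>) - \<pi>) - hamiltonian \<pi> q u
    = ((\<Sum>i\<in>UNIV. \<bar>q $ i\<bar>) - \<pi>) * (1 - infnorm u)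
      + (\<Sum>i\<in>UNIV. \<bar>q $ i\<bar> * (infnorm u - sgn (q $ i) * u $ i))"
proof -
  have "\<bar>q $ i\<bar> * (infnorm u - sgn (q $ i) * u $ i) = \<bar>q $ i\<bar> * infnorm u - q $ i * u $ i" for i
    by (simp add: right_diff_distrib abs_mult_sgn flip: mult.assoc)
  then have "(\<Sum>i\<in>UNIV. \<bar>q $ i\<bar> * (infnorm u - sgn (q $ i) * u $ i))
      = (\<Sum>i\<in>UNIV. \<bar>q $ i\<bar>) * infnorm u - q \<bullet> u"
    by (simp add: sum_subtractf sum_distrib_right inner_vec_def)
  then show ?thesis
    by (simp add: hamiltonian_def algebra_simps)
qed

lemma sgn_mult_le_infnorm: "sgn (c::real) * u $ i \<le> infnorm u" for u :: "real^'m"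
  using component_le_infnorm_cart[of u i] by (auto simp: sgn_if infnorm_pos_le)

lemma hamiltonian_le_bang:
  assumes "\<pi> \<ge> 0" "infnorm u \<le> 1"
  shows "hamiltonian \<pi> q u \<le> hamiltonian \<pi> q (bang \<pi> q)"
proof -
  define S where "S = (\<Sum>i\<in>UNIV. \<bar>q $ i\<bar>)"
  have nonneg: "(\<Sum>i\<in>UNIV. \<bar>q $ i\<bar> * (infnorm u - sgn (q $ i) * u $ i)) \<ge> 0"
    by (intro sum_nonneg mult_nonneg_nonneg) (auto simp: sgn_mult_le_infnorm)
  have le: "hamiltonian \<pi> q u \<le> (S - \<pi>) * infnorm u"
    using hamiltonian_gap[of q \<pi> u] nonneg by (simp add: S_def algebra_simps)
  also have "\<dots> \<le> max 0 (S - \<pi>) * 1"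
    using assms infnorm_pos_le[of u] by (intro mult_mono) auto
  finally show ?thesis
    by (simp add: bang_hamiltonian[OF assms(1)] S_def)
qed

text \<open>
  A quantitative form of uniqueness of the maximizer: the gap in \<open>hamiltonian_gap\<close> is a sum of
  nonnegative terms, each controlling one way of deviating from \<open>bang\<close>. The linear bound turns
  convergence of the Hamiltonians into convergence of the controls.
\<close>
lemma bang_unique_maximizer:
  fixes q :: "real^'m"
  assumes "\<pi> \<ge> 0" and neq: "(\<Sum>i\<in>UNIV. \<bar>q $ i\<bar>) \<noteq> \<pi>"
    and nz: "\<pi> < (\<Sum>i\<in>UNIV. \<bar>q $ i\<bar>) \<Longrightarrow> \<forall>i. q $ i \<noteq> 0"
  obtains K where "\<And>u. infnorm u \<le> 1 \<Longrightarrow>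
    infnorm (u - bang \<pi> q) \<le> K * (hamiltonian \<pi> q (bang \<pi> q) - hamiltonian \<pi> q u)"
proof -
  define S where "S = (\<Sum>i\<in>UNIV. \<bar>q $ i\<bar>)"
  define D where "D u = hamiltonian \<pi> q (bang \<pi> q) - hamiltonian \<pi> q u" for u
  have nonneg: "(\<Sum>i\<in>UNIV. \<bar>q $ i\<bar> * (infnorm u - sgn (q $ i) * u $ i)) \<ge> 0" for u
    by (intro sum_nonneg mult_nonneg_nonneg) (auto simp: sgn_mult_le_infnorm)
  show ?thesis
  proof (cases "\<pi> < S")
    case False
    have "infnorm (u - bang \<pi> q) \<le> 1 / (\<pi> - S) * D u" if "infnorm u \<le> 1" for u
    proof -
      have "(\<pi> - S) * infnorm u \<le> D u"
        using hamiltonian_gap[of q \<pi> u] nonneg[of u] False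
        by (simp add: S_def D_def bang_hamiltonian[OF assms(1)] algebra_simps)
      moreover have "\<pi> - S > 0" using False neq by (simp add: S_def)
      moreover have "bang \<pi> q = 0" using False by (simp add: bang_def S_def)
      ultimately show ?thesis by (simp add: field_simps)
    qed
    then show ?thesis by (intro that[of "1 / (\<pi> - S)"]) (simp add: D_def)
  next
    case True
    define K where "K = 1 / (S - \<pi>) + (\<Sum>i\<in>UNIV. 1 / \<bar>q $ i\<bar>)"
    have q: "q $ i \<noteq> 0" for i using nz True by (simp add: S_def)
    have "infnorm (u - bang \<pi> q) \<le> K * D u" if u: "infnorm u \<le> 1" for u
      unfolding infnorm_le_iff_cart
    proof
      fix i
      have D: "D u = (S - \<pi>) * (1 - infnorm u) + (\<Sum>i\<in>UNIV. \<bar>q $ i\<bar> * (infnorm u - sgn (q $ i) * u $ i))"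
        using hamiltonian_gap[of q \<pi> u] True
        by (simp add: S_def D_def bang_hamiltonian[OF assms(1)])
      have "(S - \<pi>) * (1 - infnorm u) \<ge> 0"
        using True u by simp
      then have "\<bar>q $ i\<bar> * (infnorm u - sgn (q $ i) * u $ i) \<le> D u"
        using member_le_sum[of i UNIV "\<lambda>i. \<bar>q $ i\<bar> * (infnorm u - sgn (q $ i) * u $ i)"]
        by (simp add: D sgn_mult_le_infnorm)
      then have 1: "infnorm u - sgn (q $ i) * u $ i \<le> (1 / \<bar>q $ i\<bar>) * D u"
        using q[of i] by (simp add: field_simps)
      have "(S - \<pi>) * (1 - infnorm u) \<le> D u"
        using nonneg[of u] by (simp add: D)
      then have 2: "1 - infnorm u \<le> (1 / (S - \<pi>)) * D u"
        using True by (simp add: field_simps)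
      have "D u \<ge> 0"
        using hamiltonian_le_bang[OF assms(1) u] by (simp add: D_def)
      have "\<bar>u $ i\<bar> \<le> 1" using u infnorm_le_iff_cart by blast
      then have "\<bar>(u - bang \<pi> q) $ i\<bar> = 1 - sgn (q $ i) * u $ i"
        using True q[of i] by (auto simp: bang_def S_def sgn_if)
      also have "\<dots> \<le> (1 / (S - \<pi>) + 1 / \<bar>q $ i\<bar>) * D u"
        using 1 2 by (simp add: distrib_right)
      also have "\<dots> \<le> K * D u"
        unfolding K_def using \<open>D u \<ge> 0\<close>
        by (intro mult_right_mono add_left_mono member_le_sum[of i UNIV "\<lambda>i. 1 / \<bar>q $ i\<bar>"]) auto
      finally show "\<bar>(u - bang \<pi> q) $ i\<bar> \<le> K * D u" .
    qed
    then show ?thesis by (intro that[of K]) (simp add: D_def)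
  qed
qed

section \<open>Genericity of the switching function\<close>

lemma AE_lebesgue_on_if_countable_exceptions:
  assumes "countable {s :: real. \<not> P s}"
  shows "AE s in lebesgue_on {0..T}. P s"
proof -
  have "{s. \<not> P s} \<in> null_sets lebesgue"
    using assms by (intro null_sets_completionI countable_imp_null_set_lborel)
  then have "AE s in lebesgue. P s"
    by (rule AE_I') auto
  then show ?thesis
    by (subst AE_restrict_space_iff) auto
qed

text \<open>
  Nonsingularity enters here. If the function is constant, its derivative vanishes, so \<open>A *v c\<close> lies
  in the \<open>A\<close>-invariant subspace \<open>V\<close> of vectors invisible to \<open>p\<close>. An injective \<open>A\<close> maps \<open>V\<close> onto
  itself, so \<open>c\<close> lies in \<open>V\<close> too, and the constant is zero.
\<close>
lemma mexp_not_constant: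
  fixes A :: "real^'n^'n"
  assumes "invertible A" "\<pi> \<noteq> 0"
  shows "\<exists>t. p \<bullet> (mexp A t *v c) \<noteq> \<pi>"
proof (rule ccontr)
  assume "\<not> ?thesis"
  then have const: "p \<bullet> (mexp A t *v c) = \<pi>" for t by blast
  define V where "V = {v. \<forall>t. p \<bullet> (mexp A t *v v) = 0}"
  have deriv: "p \<bullet> (mexp A t *v (A *v v)) = 0" if "\<And>t. p \<bullet> (mexp A t *v v) = k" for v k t
    using DERIV_unique[OF inner_mexp_has_real_derivative[of p A v t]] that by simp
  have V: "subspace V"
    by (simp add: subspace_def V_def mv.add_right mv.scaleR_right inner_add_right)
  have inj: "inj ((*v) A)"
    using assms(1) by (simp add: inj_matrix_vector_mult)
  have "dim ((*v) A ` V) = dim V"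
    by (rule dim_image_eq[OF matrix_vector_mul_linear inj_on_subset[OF inj]]) simp
  moreover have "(*v) A ` V \<subseteq> V"
    using deriv[where k = 0] by (auto simp: V_def)
  ultimately have "(*v) A ` V = V"
    by (intro subspace_dim_equal linear_subspace_image[OF matrix_vector_mul_linear] V) auto
  moreover have "A *v c \<in> V"
    using deriv[OF const] by (simp add: V_def)
  ultimately have "A *v c \<in> (*v) A ` V" by simp
  then have "c \<in> V"
    using inj by (auto dest: injD)
  then show False
    using const assms(2) by (simp add: V_def)
qed

lemma countable_switching_level_set:
  assumes "\<exists>t. p \<bullet> (mexp A t *v (B *v v)) \<noteq> \<kappa>"
  shows "countable {s. switching A B p s \<bullet> v = \<kappa>}"
proof -
  have "countable {t. p \<bullet> (mexp A t *v (B *v v)) = \<kappa>}"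
    using assms countable_level_set_mexp by blast
  then have "countable (uminus ` {t. p \<bullet> (mexp A t *v (B *v v)) = \<kappa>})"
    by (rule countable_image)
  then show ?thesis
    by (rule countable_subset[rotated]) (auto simp: switching_inner image_iff intro!: exI[of _ "- _"])
qed

text \<open>
  At almost every time the Hamiltonian has a unique maximizer. By observability no component of the
  switching function vanishes on more than a countable set. The equation \<open>\<Sum>|q\<^sub>i| = \<pi>\<close> is split
  according to the sign pattern of \<open>q\<close>; for each of the finitely many patterns \<open>\<sigma>\<close> it says that
  \<open>p \<bullet> (mexp A (- s) *v (B *v \<sigma>)) = \<pi>\<close>, and \<open>mexp_not_constant\<close> applies.
\<close>
lemma switching_generic:
  fixes A :: "real^'n^'n" and B :: "real^'m^'n"
  assumes A: "invertible A" and obs: "\<And>j. observable A (column j B)"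
    and "\<pi> \<ge> 0" "p \<noteq> 0 \<or> \<pi> \<noteq> 0"
  shows "AE s in lebesgue_on {0..T}. (\<Sum>i\<in>UNIV. \<bar>switching A B p s $ i\<bar>) \<noteq> \<pi> \<and>
    (\<pi> < (\<Sum>i\<in>UNIV. \<bar>switching A B p s $ i\<bar>) \<longrightarrow> (\<forall>i. switching A B p s $ i \<noteq> 0))"
proof (cases "p = 0")
  case True
  then have "switching A B p s = 0" for s
    by (simp add: switching_def)
  then show ?thesis
    using assms(3,4) True by simp
next
  case False
  have comp: "AE s in lebesgue_on {0..T}. switching A B p s $ i \<noteq> 0" for i
  proof -
    have "\<exists>t. p \<bullet> (mexp A t *v (B *v axis i 1)) \<noteq> 0"
      using obs[of i] False unfolding observable_def by (auto simp: matrix_vector_mult_basis)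
    from countable_switching_level_set[OF this] show ?thesis
      by (intro AE_lebesgue_on_if_countable_exceptions) (simp add: inner_axis)
  qed
  have all: "AE s in lebesgue_on {0..T}. \<forall>i. switching A B p s $ i \<noteq> 0"
    using comp by (simp add: AE_all_countable)
  have sum: "AE s in lebesgue_on {0..T}. (\<Sum>i\<in>UNIV. \<bar>switching A B p s $ i\<bar>) \<noteq> \<pi>"
  proof (cases "\<pi> = 0")
    case True
    show ?thesis
      using all
    proof eventually_elim
      case (elim s)
      then have "(\<Sum>i\<in>UNIV. \<bar>switching A B p s $ i\<bar>) > 0"
        by (intro sum_pos) auto
      then show ?case using True by simp
    qed
  next
    case \<pi>: False
    define \<sigma> :: "'m set \<Rightarrow> real^'m" where "\<sigma> I = (\<chi> i. if i \<in> I then 1 else - 1)" for I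
    have "countable (\<Union>I\<in>UNIV. {s. switching A B p s \<bullet> \<sigma> I = \<pi>})"
      by (intro countable_UN countable_switching_level_set mexp_not_constant A \<pi>) (auto intro: countable_finite)
    moreover have "{s. \<not> (\<Sum>i\<in>UNIV. \<bar>switching A B p s $ i\<bar>) \<noteq> \<pi>}
        \<subseteq> (\<Union>I\<in>UNIV. {s. switching A B p s \<bullet> \<sigma> I = \<pi>})"
    proof
      fix s assume "s \<in> {s. \<not> (\<Sum>i\<in>UNIV. \<bar>switching A B p s $ i\<bar>) \<noteq> \<pi>}"
      then have "switching A B p s \<bullet> \<sigma> {i. switching A B p s $ i \<ge> 0} = \<pi>"
        by (auto simp: inner_vec_def \<sigma>_def intro!: sum.cong)
      then show "s \<in> (\<Union>I\<in>UNIV. {s. switching A B p s \<bullet> \<sigma> I = \<pi>})" by auto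
    qed
    ultimately show ?thesis
      by (intro AE_lebesgue_on_if_countable_exceptions) (rule countable_subset)
  qed
  show ?thesis
    using all sum by eventually_elim auto
qed

section \<open>Feasibility for large times\<close>

text \<open>
  If the required displacement \<open>\<eta>\<close> were not attained, a hyperplane with normal \<open>p\<close> would separate
  it from the convex set of attained displacements, and then \<open>p \<bullet> \<eta>\<close> would be at least the gain of
  \<open>p\<close>. But \<open>x0\<close> and \<open>xf\<close> each contribute less than half of that gain to \<open>p \<bullet> \<eta>\<close>, the latter after
  reversal of time.
\<close>
lemma eventually_feasible:
  fixes A :: "real^'n^'n" and B :: "real^'m^'n"
  assumes obs: "\<And>j. observable A (column j B)"
    and x0: "x0 \<in> L_zero_minus A" and xf: "xf \<in> L_zero_plus A"
  obtains T0 where "T0 > 0" "\<And>T. T \<ge> T0 \<Longrightarrow> \<exists>u\<in>B_infty T. steer A B T u = mexp A (- T) *v xf - x0"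
proof -
  fix j :: 'm
  let ?b = "column j B"
  obtain T1 where T1: "\<And>T p. T1 \<le> T \<Longrightarrow> p \<noteq> 0 \<Longrightarrow> 2 * \<bar>p \<bullet> x0\<bar> < gain A ?b (- 1) T p"
    by (rule gain_eventually_dominates[OF obs, of "- 1" x0 j])
      (simp, erule decay_annihilates_L_zero_minus[OF x0], blast)
  obtain T2 where T2: "\<And>T p. T2 \<le> T \<Longrightarrow> p \<noteq> 0 \<Longrightarrow> 2 * \<bar>p \<bullet> xf\<bar> < gain A ?b 1 T p"
    by (rule gain_eventually_dominates[OF obs, of 1 xf j])
      (simp, erule decay_annihilates_L_zero_plus[OF xf], blast)
  show ?thesis
  proof
    show "max 1 (max T1 T2) > 0" by simp
    fix T assume T: "T \<ge> max 1 (max T1 T2)"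
    define \<eta> where "\<eta> = mexp A (- T) *v xf - x0"
    let ?R = "steer A B T ` (B_infty T)"
    show "\<exists>u\<in>B_infty T. steer A B T u = mexp A (- T) *v xf - x0"
    proof (rule ccontr)
      assume "\<not> ?thesis"
      then have disj: "?R \<inter> {\<eta>} = {}" by (auto simp: \<eta>_def)
      have conv: "convex ?R"
      proof (rule convexI)
        fix x y and a b :: real
        assume "x \<in> ?R" "y \<in> ?R" and ab: "0 \<le> a" "0 \<le> b" "a + b = 1"
        then obtain u v where uv: "u \<in> B_infty T" "x = steer A B T u" "v \<in> B_infty T" "y = steer A B T v"
          by auto
        show "a *\<^sub>R x + b *\<^sub>R y \<in> ?R"
          using B_infty_convex_comb(1)[OF uv(1,3) ab]
          by (simp only: uv(2,4) B_infty_convex_comb(2)[OF uv(1,3) ab, symmetric] imageI)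
      qed
      have bang: "(\<lambda>s. bang 0 (switching A B p s)) \<in> B_infty T" for p
        by (intro bang_in_B_infty continuous_on_switching) auto
      from separating_hyperplane_sets[OF conv convex_singleton _ _ disj] bang
      obtain p \<beta> where p: "p \<noteq> 0" "\<And>y. y \<in> ?R \<Longrightarrow> p \<bullet> y \<le> \<beta>" "p \<bullet> \<eta> \<ge> \<beta>"
        by fastforce
      let ?q = "switching A B p"
      have "gain A ?b (- 1) T p = integral\<^sup>L (lebesgue_on {0..T}) (\<lambda>s. \<bar>?q s $ j\<bar>)"
        unfolding gain_def switching_nth
        using gain_integrand_continuous[of "{0..T}" p A "- 1" ?b]
        by (subst lebesgue_integral_eq_integral) (auto intro: continuous_imp_integrable_real)
      also have "\<dots> \<le> integral\<^sup>L (lebesgue_on {0..T}) (\<lambda>s. ?q s \<bullet> bang 0 (?q s))"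
      proof (rule integral_mono)
        show "integrable (lebesgue_on {0..T}) (\<lambda>s. \<bar>?q s $ j\<bar>)"
          by (intro continuous_imp_integrable_real continuous_intros continuous_on_switching)
        show "integrable (lebesgue_on {0..T}) (\<lambda>s. ?q s \<bullet> bang 0 (?q s))"
          by (rule switching_integrable[OF bang])
        show "\<bar>?q s $ j\<bar> \<le> ?q s \<bullet> bang 0 (?q s)" for s
          using bang_hamiltonian[of 0 "?q s"] member_le_sum[of j UNIV "\<lambda>i. \<bar>?q s $ i\<bar>"]
          by (simp add: hamiltonian_def)
      qed
      also have "\<dots> = p \<bullet> steer A B T (\<lambda>s. bang 0 (?q s))"
        by (rule inner_steer[OF bang, symmetric])
      also have "\<dots> \<le> p \<bullet> \<eta>"
        using p(2)[OF imageI[OF bang]] p(3) by (rule order_trans)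
      also have "\<dots> = (p v* mexp A (- T)) \<bullet> xf - p \<bullet> x0"
        by (simp add: \<eta>_def inner_diff_right dot_lmul_matrix)
      also have "\<dots> < gain A ?b (- 1) T p"
      proof -
        have "p v* mexp A (- T) \<noteq> 0"
          using p(1) by (simp add: vector_mexp_eq_0_iff)
        then have "2 * \<bar>(p v* mexp A (- T)) \<bullet> xf\<bar> < gain A ?b (- 1) T p"
          using T2[of T "p v* mexp A (- T)"] T by (simp add: gain_time_reversal)
        moreover have "2 * \<bar>p \<bullet> x0\<bar> < gain A ?b (- 1) T p"
          using T1[of T p] T p(1) by simp
        ultimately show ?thesis by linarith
      qed
      finally show False by simp
    qed
  qed
qed

section \<open>Existence of a minimizer\<close>

text \<open>
  Controls in the unit ball are dominated by a constant, so almost everywhere convergence passes to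
  both integrals.
\<close>
lemma steer_effort_limit:
  fixes A :: "real^'n^'n" and B :: "real^'m^'n"
  assumes u: "\<And>n. u n \<in> B_infty T" and v: "v \<in> B_infty T"
    and lim: "AE s in lebesgue_on {0..T}. (\<lambda>n. u n s) \<longlonglongrightarrow> v s"
  shows "(\<lambda>n. steer A B T (u n)) \<longlonglongrightarrow> steer A B T v"
    and "(\<lambda>n. effort T (u n)) \<longlonglongrightarrow> effort T v"
proof -
  let ?M = "lebesgue_on {0..T}"
  have bnd: "AE s in ?M. infnorm (u n s) \<le> 1" for n
    using u B_infty_iff by blast
  obtain K where K: "K > 0" "\<And>(N :: real^'m^'n) x. norm (N *v x) \<le> norm N * norm x * K"
    using mv.pos_bounded by blast
  let ?w = "\<lambda>s. norm (mexp A (- s) ** B) * sqrt (real CARD('m)) * K"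
  have w: "integrable ?M ?w"
    by (intro continuous_imp_integrable_real continuous_intros mm.continuous_on)
  show "(\<lambda>n. steer A B T (u n)) \<longlonglongrightarrow> steer A B T v"
    unfolding steer_def
  proof (rule integral_dominated_convergence[OF _ _ w])
    show "(\<lambda>s. mexp A (- s) *v (B *v v s)) \<in> borel_measurable ?M"
      by (rule borel_measurable_integrable[OF steer_integrable[OF v]])
    show "(\<lambda>s. mexp A (- s) *v (B *v u n s)) \<in> borel_measurable ?M" for n
      by (rule borel_measurable_integrable[OF steer_integrable[OF u]])
    show "AE s in ?M. (\<lambda>n. mexp A (- s) *v (B *v u n s)) \<longlonglongrightarrow> mexp A (- s) *v (B *v v s)"
      using lim by eventually_elim (intro mv.tendsto tendsto_const)
    show "AE s in ?M. norm (mexp A (- s) *v (B *v u n s)) \<le> ?w s" for n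
      using bnd[of n]
    proof eventually_elim
      case (elim s)
      have "norm (u n s) \<le> sqrt (real CARD('m)) * infnorm (u n s)"
        by (rule norm_le_infnorm_cart)
      also have "\<dots> \<le> sqrt (real CARD('m)) * 1"
        using elim by (intro mult_left_mono) auto
      finally have "norm (mexp A (- s) ** B) * norm (u n s) * K
          \<le> norm (mexp A (- s) ** B) * (sqrt (real CARD('m)) * 1) * K"
        using K(1) by (intro mult_right_mono mult_left_mono) auto
      with K(2)[of "mexp A (- s) ** B" "u n s"] show ?case
        by (simp add: matrix_vector_mul_assoc)
    qed
  qed
  show "(\<lambda>n. effort T (u n)) \<longlonglongrightarrow> effort T v"
    unfolding effort_def
  proof (rule integral_dominated_convergence[where w = "\<lambda>_. 1"])
    show "(\<lambda>s. infnorm (v s)) \<in> borel_measurable ?M"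
      by (rule borel_measurable_integrable[OF B_infty_infnorm_integrable[OF v]])
    show "(\<lambda>s. infnorm (u n s)) \<in> borel_measurable ?M" for n
      by (rule borel_measurable_integrable[OF B_infty_infnorm_integrable[OF u]])
    show "AE s in ?M. (\<lambda>n. infnorm (u n s)) \<longlonglongrightarrow> infnorm (v s)"
      using lim by eventually_elim (rule tendsto_infnorm)
    show "AE s in ?M. norm (infnorm (u n s)) \<le> 1" for n
      using bnd[of n] by (simp add: real_abs_infnorm)
    show "integrable ?M (\<lambda>_. 1 :: real)"
      by (intro continuous_imp_integrable_real continuous_intros)
  qed
qed

lemma convex_effort_epigraph:
  "convex {(steer A B T u, c) | u c. u \<in> B_infty T \<and> effort T u \<le> c}"
proof (rule convexI)
  fix x y and a b :: real
  assume "x \<in> {(steer A B T u, c) | u c. u \<in> B_infty T \<and> effort T u \<le> c}"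
    "y \<in> {(steer A B T u, c) | u c. u \<in> B_infty T \<and> effort T u \<le> c}"
    and ab: "0 \<le> a" "0 \<le> b" "a + b = 1"
  then obtain u c v d where uv: "u \<in> B_infty T" "x = (steer A B T u, c)" "effort T u \<le> c"
    "v \<in> B_infty T" "y = (steer A B T v, d)" "effort T v \<le> d"
    by auto
  note comb = B_infty_convex_comb[OF uv(1,4) ab]
  have "a * effort T u + b * effort T v \<le> a * c + b * d"
    using uv ab by (intro add_mono mult_left_mono)
  then have "effort T (\<lambda>s. a *\<^sub>R u s + b *\<^sub>R v s) \<le> a * c + b * d"
    using comb(3) by simp
  moreover have "a *\<^sub>R x + b *\<^sub>R y = (steer A B T (\<lambda>s. a *\<^sub>R u s + b *\<^sub>R v s), a * c + b * d)"
    by (simp add: uv comb(2))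
  ultimately show "a *\<^sub>R x + b *\<^sub>R y \<in> {(steer A B T u, c) | u c. u \<in> B_infty T \<and> effort T u \<le> c}"
    using comb(1) by blast
qed

text \<open>
  A Lagrange multiplier for the minimal effort. The epigraph of the effort over the attained
  displacements is convex and misses the open half-line below \<open>(\<eta>, c)\<close>, so the two can be separated.
  The separation includes the abnormal case \<open>\<pi> = 0\<close>.
\<close>
lemma effort_multiplier:
  fixes A :: "real^'n^'n" and B :: "real^'m^'n"
  assumes u0: "u0 \<in> B_infty T" "steer A B T u0 = \<eta>"
    and low: "\<And>u. u \<in> B_infty T \<Longrightarrow> steer A B T u = \<eta> \<Longrightarrow> c \<le> effort T u"
  obtains p \<pi> where "\<pi> \<ge> 0" "p \<noteq> 0 \<or> \<pi> \<noteq> 0"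
    "\<And>u. u \<in> B_infty T \<Longrightarrow> p \<bullet> steer A B T u - \<pi> * effort T u \<le> p \<bullet> \<eta> - \<pi> * c"
proof -
  let ?E = "{(steer A B T u, d) | u d. u \<in> B_infty T \<and> effort T u \<le> d}"
  let ?L = "{\<eta>} \<times> {..<c}"
  have "?E \<inter> ?L = {}"
    using low by fastforce
  moreover have "(\<eta>, effort T u0) \<in> ?E"
    using u0 by auto
  then have "?E \<noteq> {}" by blast
  moreover have "(\<eta>, c - 1) \<in> ?L" by simp
  then have "?L \<noteq> {}" by blast
  moreover have "convex ?L"
    by (intro convex_Times convex_singleton) simp
  ultimately have "\<exists>a \<beta>. a \<noteq> 0 \<and> (\<forall>x\<in>?E. a \<bullet> x \<le> \<beta>) \<and> (\<forall>x\<in>?L. \<beta> \<le> a \<bullet> x)"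
    by (intro separating_hyperplane_sets convex_effort_epigraph)
  then obtain a \<beta> where a: "a \<noteq> 0" "\<And>x. x \<in> ?E \<Longrightarrow> a \<bullet> x \<le> \<beta>" "\<And>x. x \<in> ?L \<Longrightarrow> \<beta> \<le> a \<bullet> x"
    by blast
  obtain p \<pi>' where a_eq: "a = (p, \<pi>')" by (cases a)
  define \<pi> where "\<pi> = - \<pi>'"
  have E: "p \<bullet> steer A B T u - \<pi> * effort T u \<le> \<beta>" if "u \<in> B_infty T" for u
    using a(2)[of "(steer A B T u, effort T u)"] that by (force simp: a_eq \<pi>_def)
  have L: "\<beta> \<le> p \<bullet> \<eta> - \<pi> * d" if "d < c" for d
    using a(3)[of "(\<eta>, d)"] that by (simp add: a_eq \<pi>_def)
  \<comment> \<open>The sign of \<open>\<pi>\<close> comes from comparing a point of the epigraph with one below it over the same \<open>\<eta>\<close>.\<close>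
  have "\<pi> * (effort T u0 - (c - 1)) \<ge> 0"
    using E[OF u0(1)] L[of "c - 1"] u0(2) by (simp add: algebra_simps)
  moreover have "effort T u0 - (c - 1) > 0"
    using low[OF u0] by simp
  ultimately have \<pi>: "\<pi> \<ge> 0"
    by (simp add: zero_le_mult_iff)
  have "\<beta> \<le> p \<bullet> \<eta> - \<pi> * c"
  proof (rule field_le_epsilon)
    \<comment> \<open>Let \<open>d\<close> tend to \<open>c\<close> from below; adding \<open>1\<close> to the denominator covers \<open>\<pi> = 0\<close>.\<close>
    fix e :: real assume "e > 0"
    then have "\<beta> \<le> p \<bullet> \<eta> - \<pi> * (c - e / (\<pi> + 1))"
      using \<pi> by (intro L) simp
    moreover have "\<pi> * (e / (\<pi> + 1)) \<le> e"
      using \<pi> \<open>e > 0\<close> by (simp add: field_simps)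
    ultimately show "\<beta> \<le> p \<bullet> \<eta> - \<pi> * c + e"
      by (simp add: right_diff_distrib)
  qed
  with E have "p \<bullet> steer A B T u - \<pi> * effort T u \<le> p \<bullet> \<eta> - \<pi> * c" if "u \<in> B_infty T" for u
    using that by force
  moreover have "p \<noteq> 0 \<or> \<pi> \<noteq> 0"
    using a(1) by (auto simp: a_eq \<pi>_def zero_prod_def)
  ultimately show ?thesis
    using that[of \<pi> p] \<pi> by blast
qed

lemma hamiltonian_integral:
  assumes "u \<in> B_infty T"
  shows "integrable (lebesgue_on {0..T}) (\<lambda>s. hamiltonian \<pi> (switching A B p s) (u s))"
    and "integral\<^sup>L (lebesgue_on {0..T}) (\<lambda>s. hamiltonian \<pi> (switching A B p s) (u s))
      = p \<bullet> steer A B T u - \<pi> * effort T u"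
  unfolding hamiltonian_def
  using switching_integrable[OF assms, of A B p] B_infty_infnorm_integrable[OF assms]
  by (simp_all add: inner_steer[OF assms] effort_def)

text \<open>
  Existence without weak compactness. Take a multiplier \<open>(p, \<pi>)\<close> for the infimum of the effort, and
  let \<open>u\<close> maximize the Hamiltonian pointwise. The multiplier inequality for \<open>u\<close> bounds the integrated
  gap between \<open>u\<close> and any feasible \<open>v\<close> by \<open>\<pi>\<close> times the excess effort of \<open>v\<close>. Along a minimizing
  sequence the gap thus tends to zero in \<open>L\<^sup>1\<close>, and almost everywhere for a subsequence. Uniqueness of
  the maximizer then forces this subsequence to converge to \<open>u\<close>, which therefore inherits both
  feasibility and the infimum.
\<close>
lemma minimal_effort_bang_control:
  fixes A :: "real^'n^'n" and B :: "real^'m^'n"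
  assumes A: "invertible A" and obs: "\<And>j. observable A (column j B)"
    and u0: "u0 \<in> B_infty T" "steer A B T u0 = \<eta>"
  obtains u where "u \<in> B_infty T" "steer A B T u = \<eta>" "effort T u = measure lebesgue (supp T u)"
    "\<And>v. v \<in> B_infty T \<Longrightarrow> steer A B T v = \<eta> \<Longrightarrow> effort T u \<le> effort T v"
proof -
  let ?M = "lebesgue_on {0..T}"
  define Feas where "Feas = {u \<in> B_infty T. steer A B T u = \<eta>}"
  define c where "c = Inf (effort T ` Feas)"
  have "effort T u \<ge> 0" for u :: "real \<Rightarrow> real^'m"
    unfolding effort_def by (intro Bochner_Integration.integral_nonneg infnorm_pos_le)
  then have bdd: "bdd_below (effort T ` Feas)"
    by (intro bdd_belowI[of _ 0]) auto
  have ne: "effort T ` Feas \<noteq> {}"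
    using u0 by (auto simp: Feas_def)
  have low: "c \<le> effort T u" if "u \<in> B_infty T" "steer A B T u = \<eta>" for u
    unfolding c_def using that bdd by (intro cInf_lower) (auto simp: Feas_def)
  obtain p \<pi> where \<pi>: "\<pi> \<ge> 0" "p \<noteq> 0 \<or> \<pi> \<noteq> 0"
    and mult: "\<And>u. u \<in> B_infty T \<Longrightarrow> p \<bullet> steer A B T u - \<pi> * effort T u \<le> p \<bullet> \<eta> - \<pi> * c"
    by (rule effort_multiplier[OF u0], erule (1) low, rule that)
  let ?q = "switching A B p"
  define u where "u s = bang \<pi> (?q s)" for s
  have u: "u \<in> B_infty T"
    unfolding u_def by (intro bang_in_B_infty continuous_on_switching \<pi>)

  have "\<exists>v\<in>Feas. effort T v < c + 1 / real (Suc n)" for n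
    using cInf_lessD[OF ne, of "c + 1 / real (Suc n)"] by (auto simp: c_def)
  then obtain w where w: "\<And>n. w n \<in> B_infty T" "\<And>n. steer A B T (w n) = \<eta>"
    "\<And>n. effort T (w n) < c + 1 / real (Suc n)"
    unfolding Feas_def by (metis (mono_tags, lifting) mem_Collect_eq)

  define D where "D n s = hamiltonian \<pi> (?q s) (u s) - hamiltonian \<pi> (?q s) (w n s)" for n s
  have D_int: "integrable ?M (D n)" for n
    unfolding D_def by (intro Bochner_Integration.integrable_diff hamiltonian_integral u w)
  have D_nonneg: "AE s in ?M. 0 \<le> D n s" for n
  proof -
    have "AE s in ?M. infnorm (w n s) \<le> 1"
      using w(1) B_infty_iff by blast
    then show ?thesis
      by eventually_elim (simp add: D_def u_def hamiltonian_le_bang[OF \<pi>(1)])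
  qed
  have D_bound: "integral\<^sup>L ?M (\<lambda>s. norm (D n s)) \<le> \<pi> * (1 / real (Suc n))" for n
  proof -
    have "integral\<^sup>L ?M (\<lambda>s. norm (D n s)) = integral\<^sup>L ?M (D n)"
      using D_nonneg[of n] D_int[of n] by (intro integral_cong_AE) auto
    also have "\<dots> = (p \<bullet> steer A B T u - \<pi> * effort T u) - (p \<bullet> \<eta> - \<pi> * effort T (w n))"
      unfolding D_def
      by (simp add: Bochner_Integration.integral_diff hamiltonian_integral u w)
    also have "\<dots> \<le> \<pi> * (effort T (w n) - c)"
      using mult[OF u] by (simp add: algebra_simps)
    also have "\<dots> \<le> \<pi> * (1 / real (Suc n))"
      using w(3)[of n] \<pi>(1) by (intro mult_left_mono) auto
    finally show ?thesis .
  qed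
  have "(\<lambda>n. \<pi> * (1 / real (Suc n))) \<longlonglongrightarrow> \<pi> * 0"
    by (intro tendsto_mult tendsto_const lim_1_over_n[THEN LIMSEQ_Suc])
  then have upper: "(\<lambda>n. \<pi> * (1 / real (Suc n))) \<longlonglongrightarrow> 0"
    by simp
  have "0 \<le> integral\<^sup>L ?M (\<lambda>s. norm (D n s))" for n
    by (intro Bochner_Integration.integral_nonneg) simp
  then have "(\<lambda>n. integral\<^sup>L ?M (\<lambda>s. norm (D n s))) \<longlonglongrightarrow> 0"
    by (intro tendsto_sandwich[OF _ _ tendsto_const upper] always_eventually allI D_bound)
  then obtain r where r: "strict_mono r" "AE s in ?M. (\<lambda>n. D (r n) s) \<longlonglongrightarrow> 0"
    using tendsto_L1_AE_subseq[of ?M D, OF D_int] by blast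

  have w_bound: "AE s in ?M. \<forall>n. infnorm (w n s) \<le> 1"
    using w(1) by (simp add: AE_all_countable B_infty_iff)
  have lim: "AE s in ?M. (\<lambda>n. w (r n) s) \<longlonglongrightarrow> u s"
    using switching_generic[OF A obs \<pi>, of T] w_bound r(2)
  proof eventually_elim
    case (elim s)
    obtain K where K: "\<And>v. infnorm v \<le> 1 \<Longrightarrow> infnorm (v - bang \<pi> (?q s))
        \<le> K * (hamiltonian \<pi> (?q s) (bang \<pi> (?q s)) - hamiltonian \<pi> (?q s) v)"
      using bang_unique_maximizer[OF \<pi>(1), of "?q s"] elim(1) by blast
    have bound: "\<forall>n. norm (w (r n) s - u s) \<le> sqrt (real CARD('m)) * (K * D (r n) s)"
    proof
      fix n
      have "infnorm (w (r n) s - u s) \<le> K * D (r n) s"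
        using K[of "w (r n) s"] elim(2) by (simp add: D_def u_def)
      then have "sqrt (real CARD('m)) * infnorm (w (r n) s - u s) \<le> sqrt (real CARD('m)) * (K * D (r n) s)"
        by (intro mult_left_mono) auto
      with norm_le_infnorm_cart[of "w (r n) s - u s"]
      show "norm (w (r n) s - u s) \<le> sqrt (real CARD('m)) * (K * D (r n) s)" by linarith
    qed
    have "(\<lambda>n. sqrt (real CARD('m)) * (K * D (r n) s)) \<longlonglongrightarrow> sqrt (real CARD('m)) * (K * 0)"
      by (intro tendsto_intros elim(3))
    then have "(\<lambda>n. w (r n) s - u s) \<longlonglongrightarrow> 0"
      unfolding mult_zero_right by (rule Lim_null_comparison[OF always_eventually[OF bound]])
    then show ?case by (rule LIM_zero_cancel)
  qed
  have "(\<lambda>n. steer A B T (w (r n))) \<longlonglongrightarrow> steer A B T u"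
    using lim by (intro steer_effort_limit w u)
  then have steer: "steer A B T u = \<eta>"
    by (simp add: w(2) LIMSEQ_const_iff)
  have "(\<lambda>n. effort T (w (r n))) \<longlonglongrightarrow> effort T u"
    using lim by (intro steer_effort_limit w u)
  moreover have "(\<lambda>n. c + 1 / real (Suc (r n))) \<longlonglongrightarrow> c + 0"
    using LIMSEQ_subseq_LIMSEQ[OF lim_1_over_n[THEN LIMSEQ_Suc] r(1)]
    by (intro tendsto_add tendsto_const) (simp add: o_def)
  ultimately have "effort T u \<le> c + 0"
    by (rule LIMSEQ_le) (use w(3) less_imp_le in blast)
  then have "effort T u \<le> effort T v" if "v \<in> B_infty T" "steer A B T v = \<eta>" for v
    using low[OF that] by simp
  moreover have "effort T u = measure lebesgue (supp T u)"
    by (rule effort_le_measure_supp(2)[OF u]) (simp add: u_def infnorm_bang[OF \<pi>(1)])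
  ultimately show ?thesis
    using that u steer by blast
qed

text \<open>
  The chain \<open>\<mu>(supp u) = effort u \<le> effort v \<le> \<mu>(supp v)\<close> for the bang-off-bang control \<open>u\<close> of minimal
  effort and an arbitrary competitor \<open>v\<close>.
\<close>
theorem mainTheorem2:
  fixes A :: "real^'n^'n" and B :: "real^'m^'n" and x0 xf :: "real^'n"
  assumes "invertible A"
    and "\<And>j. controllable A (columnvector (column j B) :: real^1^'n)"
    and "x0 \<in> L_zero_minus A"
    and "xf \<in> L_zero_plus A"
  shows "\<exists>T0>0. \<forall>T\<ge>T0. \<exists>u. max_hands_off A B T x0 xf u"
proof -
  have obs: "observable A (column j B)" for j
    using controllable_imp_observable[OF assms(2)] unfolding observable_def by blast
  obtain T0 where T0: "T0 > 0"
    "\<And>T. T \<ge> T0 \<Longrightarrow> \<exists>u\<in>B_infty T. steer A B T u = mexp A (- T) *v xf - x0"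
    using eventually_feasible[OF obs assms(3,4)] by blast
  have "\<exists>u. max_hands_off A B T x0 xf u" if "T \<ge> T0" for T
  proof -
    obtain u0 where u0: "u0 \<in> B_infty T" "steer A B T u0 = mexp A (- T) *v xf - x0"
      using T0(2)[OF \<open>T \<ge> T0\<close>] by blast
    obtain u where u: "u \<in> B_infty T" "steer A B T u = mexp A (- T) *v xf - x0"
      "effort T u = measure lebesgue (supp T u)"
      "\<And>v. v \<in> B_infty T \<Longrightarrow> steer A B T v = mexp A (- T) *v xf - x0 \<Longrightarrow> effort T u \<le> effort T v"
      using minimal_effort_bang_control[OF assms(1) obs u0] by blast
    have "0 \<le> T" using T0(1) that by simp
    have "measure lebesgue (supp T u) \<le> measure lebesgue (supp T v)"
      if v: "v \<in> B_infty T" "takes A B v T x0 xf" for v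
      using u(3) u(4)[OF v(1)] takes_iff_steer[OF v(1) \<open>0 \<le> T\<close>] v(2) effort_le_measure_supp(1)[OF v(1)]
      by (metis order_trans)
    then show ?thesis
      unfolding max_hands_off_def
      using u(1,2) takes_iff_steer[OF u(1) \<open>0 \<le> T\<close>] by blast
  qed
  then show ?thesis using T0(1) by blast
qed

end
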